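(* There exists a 9-dimensional nilpotent Lie group $G$, with Lie algebra $\mathfrak g$, such that (1) $G$ admits a left-invariant Riemannian metric which is a Ricci soliton, and (2) the group $\mathbb R^{>0}\times \operatorname{Aut}(\mathfrak g)_0$ does not act transitively on $GL(9)/O(9)$, and the orbits of $\mathbb R^{>0}\times \operatorname{Aut}(\mathfrak g)_0$ in $GL(9)/O(9)$ are all congruent.
   Context: For an $n$-dimensional real Lie algebra $\mathfrak g$ (identified with $\mathbb R^n$ by a choice of basis), the set of inner products on $\mathfrak g$ (equivalently, of left-invariant Riemannian metrics on a Lie group $G$ with Lie algebra $\mathfrak g$) is identified with the symmetric space $GL(n)/O(n)$, $GL(n)=GL(n,\mathbb R)$, where $g\in GL(n)$ acts on inner products by $g\cdot\langle\cdot,\cdot\rangle=\langle g^{-1}\cdot,g^{-1}\cdot\rangle$. $\operatorname{Aut}(\mathfrak g)\subset GL(n)$ is the automorphism group of $\mathfrak g$ and $\operatorname{Aut}(\mathfrak g)_0$ is its identity component. $\mathbb R^{>0}\times \operatorname{Aut}(\mathfrak g)_0$ denotes the connected subgroup of $GL(n)$ generated by positive scalar multiples of the identity and $\operatorname{Aut}(\mathfrak g)_0$; it acts on $GL(n)/O(n)$ as a subgroup of $GL(n)$. Two orbits in $GL(n)/O(n)$ are congruent if there is $\phi\in GL(n)$, viewed as an isometry of the symmetric space $GL(n)/O(n)$, which sends one orbit onto the other. A Riemannian metric $g$ is a Ricci soliton if $\operatorname{Ric}_g=c\,g+\mathcal L_X g$ for some $c\in\mathbb R$ and some smooth vector field $X$.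 *)

theory Defs
  imports
    "HOL-Analysis.Analysis"
    "HOL-Algebra.Left_Coset"
    "HOL-Algebra.Group_Action"
    "HOL-Algebra.Generated_Groups"
begin

section \<open>Smooth manifolds\<close>

text \<open>Intended for open \<open>S\<close>, where the Frechet derivative is unique.\<close>

primrec Ck_on :: "nat \<Rightarrow> 'e::real_normed_vector set \<Rightarrow> ('e \<Rightarrow> 'f::real_normed_vector) \<Rightarrow> bool" where
  "Ck_on 0 S f \<longleftrightarrow> continuous_on S f"
| "Ck_on (Suc k) S f \<longleftrightarrow>
     (\<forall>x\<in>S. f differentiable (at x)) \<and>
     (\<forall>v. Ck_on k S (\<lambda>x. frechet_derivative f (at x) v))"

definition smooth_on :: "'e::real_normed_vector set \<Rightarrow> ('e \<Rightarrow> 'f::real_normed_vector) \<Rightarrow> bool" where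
  "smooth_on S f \<longleftrightarrow> (\<forall>k. Ck_on k S f)"

type_synonym ('a, 'e) chart = "'a set \<times> ('a \<Rightarrow> 'e)"

text \<open>The coordinate representation of \<open>f\<close> with respect to a chart \<open>c\<close> of the source and a
  chart \<open>d\<close> of the target; it is meaningful on \<open>local_dom f c d\<close> only.\<close>

definition local_dom :: "('a \<Rightarrow> 'b) \<Rightarrow> ('a, 'e) chart \<Rightarrow> ('b, 'f) chart \<Rightarrow> 'e set" where
  "local_dom f c d = snd c ` {p \<in> fst c. f p \<in> fst d}"

definition local_rep :: "('a \<Rightarrow> 'b) \<Rightarrow> ('a, 'e) chart \<Rightarrow> ('b, 'f) chart \<Rightarrow> 'e \<Rightarrow> 'f" where
  "local_rep f c d = snd d \<circ> f \<circ> inv_into (fst c) (snd c)"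

text \<open>The openness clause is continuity of \<open>f\<close>. For \<open>A = B\<close> and \<open>f = id\<close>
  the definition says that the charts of \<open>A\<close> are pairwise smoothly compatible and have open
  images.\<close>

definition smooth_map ::
  "('a, 'e::real_normed_vector) chart set \<Rightarrow> ('b, 'f::real_normed_vector) chart set \<Rightarrow> ('a \<Rightarrow> 'b) \<Rightarrow> bool"
  where
  "smooth_map A B f \<longleftrightarrow>
     (\<forall>c\<in>A. \<forall>d\<in>B. open (local_dom f c d) \<and> smooth_on (local_dom f c d) (local_rep f c d))"

definition smooth_atlas :: "'a set \<Rightarrow> ('a, 'e::real_normed_vector) chart set \<Rightarrow> bool" where
  "smooth_atlas M A \<longleftrightarrow>
     (\<Union>c\<in>A. fst c) = M \<and> (\<forall>c\<in>A. inj_on (snd c) (fst c)) \<and> smooth_map A A id"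

definition manifold_topology :: "('a, 'e::real_normed_vector) chart set \<Rightarrow> 'a topology" where
  "manifold_topology A =
     topology (\<lambda>U. U \<subseteq> (\<Union>c\<in>A. fst c) \<and> (\<forall>c\<in>A. open (snd c ` (U \<inter> fst c))))"

lemma openin_manifold_topology:
  assumes "smooth_atlas M A"
  shows "openin (manifold_topology A) U \<longleftrightarrow>
           U \<subseteq> M \<and> (\<forall>c\<in>A. open (snd c ` (U \<inter> fst c)))"
proof -
  let ?P = "\<lambda>U. U \<subseteq> (\<Union>c\<in>A. fst c) \<and> (\<forall>c\<in>A. open (snd c ` (U \<inter> fst c)))"
  have "istopology ?P"
    unfolding istopology_def
  proof (intro conjI allI impI)
    fix S T assume S: "?P S" and T: "?P T"
    show "S \<inter> T \<subseteq> (\<Union>c\<in>A. fst c)" using S by blast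
    show "\<forall>c\<in>A. open (snd c ` (S \<inter> T \<inter> fst c))"
    proof
      fix c assume c: "c \<in> A"
      have "inj_on (snd c) (fst c)" using assms c by (auto simp: smooth_atlas_def)
      then have "snd c ` (S \<inter> T \<inter> fst c) = snd c ` (S \<inter> fst c) \<inter> snd c ` (T \<inter> fst c)"
        by (fastforce simp: inj_on_def)
      then show "open (snd c ` (S \<inter> T \<inter> fst c))" using S T c by auto
    qed
  next
    fix K assume K: "\<forall>U\<in>K. ?P U"
    show "\<Union>K \<subseteq> (\<Union>c\<in>A. fst c)" using K by blast
    show "\<forall>c\<in>A. open (snd c ` (\<Union>K \<inter> fst c))"
    proof
      fix c assume c: "c \<in> A"
      have "snd c ` (\<Union>K \<inter> fst c) = (\<Union>U\<in>K. snd c ` (U \<inter> fst c))" by auto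
      then show "open (snd c ` (\<Union>K \<inter> fst c))" using K c by auto
    qed
  qed
  then show ?thesis
    using assms by (simp add: manifold_topology_def topology_inverse' smooth_atlas_def)
qed

definition smooth_manifold :: "'a set \<Rightarrow> ('a, 'e::real_normed_vector) chart set \<Rightarrow> bool" where
  "smooth_manifold M A \<longleftrightarrow>
     smooth_atlas M A \<and> Hausdorff_space (manifold_topology A) \<and>
     second_countable (manifold_topology A)"

definition product_atlas ::
  "('a, 'e) chart set \<Rightarrow> ('b, 'f) chart set \<Rightarrow> ('a \<times> 'b, 'e \<times> 'f) chart set" where
  "product_atlas A B = (\<lambda>(c, d). (fst c \<times> fst d, map_prod (snd c) (snd d))) ` (A \<times> B)"


section \<open>Tensor fields in coordinates\<close>

text \<open>A vector field or a metric is a family of coordinate expressions, one for each chart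
  \<open>c\<close> of the atlas, of which only the values on the coordinate domain \<open>snd c ` fst c\<close> matter.
  Invariance under the identity map is the tensorial transformation law under a change of charts.\<close>

type_synonym ('a, 'n) vector_field = "('a, real^'n) chart \<Rightarrow> real^'n \<Rightarrow> real^'n"
type_synonym ('a, 'n) metric = "('a, real^'n) chart \<Rightarrow> real^'n \<Rightarrow> real^'n^'n"

definition invariant_field ::
  "('a, real^'n) chart set \<Rightarrow> ('a \<Rightarrow> 'a) \<Rightarrow> ('a, 'n::finite) vector_field \<Rightarrow> bool" where
  "invariant_field A f X \<longleftrightarrow>
     (\<forall>c\<in>A. \<forall>d\<in>A. \<forall>x\<in>local_dom f c d.
        X d (local_rep f c d x) = frechet_derivative (local_rep f c d) (at x) (X c x))"

definition invariant_metric ::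
  "('a, real^'n) chart set \<Rightarrow> ('a \<Rightarrow> 'a) \<Rightarrow> ('a, 'n::finite) metric \<Rightarrow> bool" where
  "invariant_metric A f g \<longleftrightarrow>
     (\<forall>c\<in>A. \<forall>d\<in>A. \<forall>x\<in>local_dom f c d. \<forall>u v.
        frechet_derivative (local_rep f c d) (at x) u \<bullet>
          (g d (local_rep f c d x) *v frechet_derivative (local_rep f c d) (at x) v) =
        u \<bullet> (g c x *v v))"

definition smooth_vector_field ::
  "('a, real^'n) chart set \<Rightarrow> ('a, 'n::finite) vector_field \<Rightarrow> bool" where
  "smooth_vector_field A X \<longleftrightarrow>
     (\<forall>c\<in>A. smooth_on (snd c ` fst c) (X c)) \<and> invariant_field A id X"

definition riemannian_metric ::
  "('a, real^'n) chart set \<Rightarrow> ('a, 'n::finite) metric \<Rightarrow> bool" where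
  "riemannian_metric A g \<longleftrightarrow>
     (\<forall>c\<in>A. smooth_on (snd c ` fst c) (g c) \<and>
        (\<forall>x \<in> snd c ` fst c. transpose (g c x) = g c x \<and>
           (\<forall>v. v \<noteq> 0 \<longrightarrow> v \<bullet> (g c x *v v) > 0))) \<and>
     invariant_metric A id g"

definition lie_bracket ::
  "(real^'n \<Rightarrow> real^'n) \<Rightarrow> (real^'n \<Rightarrow> real^'n) \<Rightarrow> real^'n \<Rightarrow> real^'n::finite" where
  "lie_bracket X Y x =
     frechet_derivative Y (at x) (X x) - frechet_derivative X (at x) (Y x)"

definition partial :: "'n::finite \<Rightarrow> (real^'n \<Rightarrow> real) \<Rightarrow> real^'n \<Rightarrow> real" where
  "partial i f x = frechet_derivative f (at x) (axis i 1)"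

text \<open>\<open>christoffel g k i j\<close> is the symbol with upper index \<open>k\<close> and lower indices \<open>i\<close>, \<open>j\<close>. The
  sign of \<open>ricci\<close> is the one for which round spheres have positive Ricci curvature.\<close>

definition christoffel :: "(real^'n \<Rightarrow> real^'n^'n) \<Rightarrow> 'n::finite \<Rightarrow> 'n \<Rightarrow> 'n \<Rightarrow> real^'n \<Rightarrow> real" where
  "christoffel g k i j x =
     (\<Sum>l\<in>UNIV. matrix_inv (g x) $ k $ l *
        (partial i (\<lambda>y. g y $ j $ l) x + partial j (\<lambda>y. g y $ i $ l) x
          - partial l (\<lambda>y. g y $ i $ j) x)) / 2"

definition ricci :: "(real^'n \<Rightarrow> real^'n^'n) \<Rightarrow> 'n::finite \<Rightarrow> 'n \<Rightarrow> real^'n \<Rightarrow> real" where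
  "ricci g i j x =
     (\<Sum>k\<in>UNIV. partial k (christoffel g k i j) x - partial j (christoffel g k i k) x) +
     (\<Sum>k\<in>UNIV. \<Sum>l\<in>UNIV.
        christoffel g k k l x * christoffel g l i j x
        - christoffel g k j l x * christoffel g l i k x)"

definition lie_derivative_metric ::
  "(real^'n \<Rightarrow> real^'n) \<Rightarrow> (real^'n \<Rightarrow> real^'n^'n) \<Rightarrow> 'n::finite \<Rightarrow> 'n \<Rightarrow> real^'n \<Rightarrow> real" where
  "lie_derivative_metric X g i j x =
     (\<Sum>k\<in>UNIV. X x $ k * partial k (\<lambda>y. g y $ i $ j) x
        + g x $ k $ j * partial i (\<lambda>y. X y $ k) x
        + g x $ i $ k * partial j (\<lambda>y. X y $ k) x)"

definition ricci_soliton ::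
  "('a, real^'n) chart set \<Rightarrow> ('a, 'n::finite) metric \<Rightarrow> bool" where
  "ricci_soliton A g \<longleftrightarrow>
     riemannian_metric A g \<and>
     (\<exists>(\<kappa>::real) X. smooth_vector_field A X \<and>
        (\<forall>c\<in>A. \<forall>x \<in> snd c ` fst c. \<forall>i j.
           ricci (g c) i j x = \<kappa> * g c x $ i $ j + lie_derivative_metric (X c) (g c) i j x))"


section \<open>Lie groups and Lie algebras\<close>

text \<open>The topology and the smooth structure of a Lie group come from the atlas only, so its carrier
  is a bare set; a set of real vectors is general enough, because every second countable manifold
  has at most the cardinality of the continuum.\<close>

definition lie_group ::
  "('a, 'b) monoid_scheme \<Rightarrow> ('a, 'e::real_normed_vector) chart set \<Rightarrow> bool" where
  "lie_group G A \<longleftrightarrow>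
     group G \<and> smooth_manifold (carrier G) A \<and>
     smooth_map (product_atlas A A) A (\<lambda>(p, q). p \<otimes>\<^bsub>G\<^esub> q) \<and>
     smooth_map A A (\<lambda>p. inv\<^bsub>G\<^esub> p)"

definition left_invariant_field ::
  "('a, 'b) monoid_scheme \<Rightarrow> ('a, real^'n) chart set \<Rightarrow> ('a, 'n::finite) vector_field \<Rightarrow> bool" where
  "left_invariant_field G A X \<longleftrightarrow>
     smooth_vector_field A X \<and> (\<forall>a\<in>carrier G. invariant_field A (\<lambda>p. a \<otimes>\<^bsub>G\<^esub> p) X)"

definition left_invariant_metric ::
  "('a, 'b) monoid_scheme \<Rightarrow> ('a, real^'n) chart set \<Rightarrow> ('a, 'n::finite) metric \<Rightarrow> bool" where
  "left_invariant_metric G A g \<longleftrightarrow>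
     riemannian_metric A g \<and> (\<forall>a\<in>carrier G. invariant_metric A (\<lambda>p. a \<otimes>\<^bsub>G\<^esub> p) g)"

definition lie_algebra :: "('v::real_vector \<Rightarrow> 'v \<Rightarrow> 'v) \<Rightarrow> bool" where
  "lie_algebra br \<longleftrightarrow>
     bilinear br \<and> (\<forall>x. br x x = 0) \<and>
     (\<forall>x y z. br x (br y z) + br y (br z x) + br z (br x y) = 0)"

text \<open>\<open>br\<close> is the bracket of the Lie algebra of \<open>G\<close> (the left-invariant vector fields) expressed in
  some basis: \<open>E\<close> is a linear isomorphism from \<open>real^'n\<close> onto the left-invariant vector fields,
  fields being identified when they agree on all coordinate domains.\<close>

definition is_lie_algebra_of ::
  "('a, 'b) monoid_scheme \<Rightarrow> ('a, real^'n) chart set \<Rightarrow>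
     (real^'n \<Rightarrow> real^'n \<Rightarrow> real^'n::finite) \<Rightarrow> bool" where
  "is_lie_algebra_of G A br \<longleftrightarrow>
     (\<exists>E :: real^'n \<Rightarrow> ('a, 'n) vector_field.
        (\<forall>u. left_invariant_field G A (E u)) \<and>
        (\<forall>c\<in>A. \<forall>x \<in> snd c ` fst c. linear (\<lambda>u. E u c x)) \<and>
        (\<forall>X. left_invariant_field G A X \<longrightarrow>
           (\<exists>!u. \<forall>c\<in>A. \<forall>x \<in> snd c ` fst c. X c x = E u c x)) \<and>
        (\<forall>u v. \<forall>c\<in>A. \<forall>x \<in> snd c ` fst c. E (br u v) c x = lie_bracket (E u c) (E v c) x))"

primrec lower_central_series :: "('v::real_vector \<Rightarrow> 'v \<Rightarrow> 'v) \<Rightarrow> nat \<Rightarrow> 'v set" where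
  "lower_central_series br 0 = UNIV"
| "lower_central_series br (Suc k) = span {br x y | x y. y \<in> lower_central_series br k}"

definition nilpotent_lie_algebra :: "('v::real_vector \<Rightarrow> 'v \<Rightarrow> 'v) \<Rightarrow> bool" where
  "nilpotent_lie_algebra br \<longleftrightarrow> lie_algebra br \<and> (\<exists>k. lower_central_series br k = {0})"

text \<open>A nilpotent Lie group is understood to be connected, so that nilpotency of the group and of
  its Lie algebra \<open>br\<close> agree.\<close>

definition nilpotent_lie_group ::
  "('a, 'b) monoid_scheme \<Rightarrow> ('a, real^'n) chart set \<Rightarrow>
     (real^'n \<Rightarrow> real^'n \<Rightarrow> real^'n::finite) \<Rightarrow> bool" where
  "nilpotent_lie_group G A br \<longleftrightarrow>
     lie_group G A \<and> connected_space (manifold_topology A) \<and>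
     is_lie_algebra_of G A br \<and> nilpotent_lie_algebra br"


section \<open>Orbits in the space of inner products\<close>

definition GL :: "(real^'n^'n::finite) monoid" where
  "GL = \<lparr>carrier = {M. invertible M}, mult = (**), one = mat 1\<rparr>"

definition O_n :: "(real^'n^'n::finite) set" where
  "O_n = {M. orthogonal_matrix M}"

definition GL_mod_O :: "(real^'n^'n::finite) set set" where
  "GL_mod_O = lcosets\<^bsub>GL\<^esub> O_n"

definition Aut :: "(real^'n \<Rightarrow> real^'n \<Rightarrow> real^'n::finite) \<Rightarrow> (real^'n^'n) set" where
  "Aut br = {M. invertible M \<and> (\<forall>x y. M *v br x y = br (M *v x) (M *v y))}"

definition Aut0 :: "(real^'n \<Rightarrow> real^'n \<Rightarrow> real^'n::finite) \<Rightarrow> (real^'n^'n) set" where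
  "Aut0 br = connected_component_set (Aut br) (mat 1)"

definition RAut0 :: "(real^'n \<Rightarrow> real^'n \<Rightarrow> real^'n::finite) \<Rightarrow> (real^'n^'n) set" where
  "RAut0 br = generate GL ({t *\<^sub>R mat 1 | t. t > 0} \<union> Aut0 br)"

text \<open>\<open>GL\<close> acts on the cosets \<open>M O(n)\<close> by left multiplication; the coset of \<open>M\<close> corresponds to the
  inner product of \<open>inverse M x\<close> and \<open>inverse M y\<close>.\<close>

definition GL_orbit :: "(real^'n^'n::finite) set \<Rightarrow> (real^'n^'n) set \<Rightarrow> (real^'n^'n) set set" where
  "GL_orbit H p = orbit (GL\<lparr>carrier := H\<rparr>) (\<lambda>h q. h <#\<^bsub>GL\<^esub> q) p"

definition transitive_on_GL_mod_O :: "(real^'n^'n::finite) set \<Rightarrow> bool" where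
  "transitive_on_GL_mod_O H \<longleftrightarrow> (\<forall>p\<in>GL_mod_O. GL_orbit H p = GL_mod_O)"

definition congruent_orbits ::
  "(real^'n^'n::finite) set set \<Rightarrow> (real^'n^'n) set set \<Rightarrow> bool" where
  "congruent_orbits P Q \<longleftrightarrow> (\<exists>\<phi>\<in>carrier GL. (\<lambda>q. \<phi> <#\<^bsub>GL\<^esub> q) ` P = Q)"

end

(* The example is the two-step nilpotent Lie algebra R^5 + R^4 whose bracket is the projection of
   Lambda^2 R^5 onto the four-dimensional summand W, where R^5 is the irreducible representation of
   the alternating group A_5. By Schur's lemma the two quadratic expressions that make up the Ricci
   tensor are scalars on R^5 and on R^4, so Ric is a multiple of the metric plus the Lie derivative
   along the vector field of the grading derivation (1 on R^5, 2 on R^4).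

   The rank two forms in W form exactly five lines. Automorphisms permute them, hence Aut_0 fixes
   each of them, which forces an element of Aut_0 to be a scalar a on the quotient R^5 and a^2 on the
   center. Therefore R^{>0} x Aut_0 consists of the matrices that are a positive scalar on the
   quotient and another one on the center. This group is normalized by the stabilizer of the center,
   a parabolic subgroup, which is transitive on GL(9)/O(9): all orbits are congruent. It is not
   transitive itself, because it changes the induced metric on the quotient only by a scalar factor. *)

theory Submission
  imports Defs
begin

text \<open>With suitable signs, the five lines are spanned by the vertices of a regular simplex in
  R^4. The only linear relation between these vertices is that their sum is zero, so a linear map
  that fixes all five lines has a single eigenvalue; this makes Aut_0 scalar on the center. A form
  outside the five lines has rank four, hence a one-dimensional kernel in R^5. Once the center is
  only scaled, each such kernel is an invariant line of the quotient, and nine of these lines are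
  enough to make the quotient scalar too. The bracket ties the two scalars together, and R^{>0}
  makes them independent again.

  The obstacle is that Ricci tensor and Lie derivative are given in coordinates. In exponential
  coordinates left translations are affine, so the metric and the Christoffel symbols are
  polynomial, and the Ricci tensor becomes a combination of traces of operators built from the
  bracket and its adjoint; most of them vanish because double brackets do. Schur's lemma itself is
  not invoked: its two conclusions are verified in an explicit basis.\<close>

section \<open>Smooth maps between normed spaces\<close>

lemma Ck_on_Suc_if_has_derivative:
  assumes f: "\<And>x. (f has_derivative f' x) (at x)"
    and f': "\<And>v. Ck_on k UNIV (\<lambda>x. f' x v)"
  shows "Ck_on (Suc k) UNIV f"
proof -
  have "frechet_derivative f (at x) = f' x" for x
    using frechet_derivative_at[OF f] by simp
  then show ?thesis
    using f f' by (auto intro: differentiableI)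
qed

lemma Ck_on_Suc_has_derivative:
  assumes "Ck_on (Suc k) UNIV f"
  shows "(f has_derivative frechet_derivative f (at x)) (at x)"
    and "Ck_on k UNIV (\<lambda>x. frechet_derivative f (at x) v)"
  using assms by (simp_all add: frechet_derivative_works[symmetric])

lemma Ck_on_Suc_imp_Ck_on: "Ck_on (Suc k) UNIV f \<Longrightarrow> Ck_on k UNIV f"
proof (induction k arbitrary: f)
  case 0
  then show ?case
    by (auto simp: continuous_on_eq_continuous_at intro: differentiable_imp_continuous_within)
next
  case (Suc k)
  then show ?case by (subst Ck_on.simps(2)) (use Suc.prems in \<open>simp only: Ck_on.simps(2), blast\<close>)
qed

lemma Ck_on_const: "Ck_on k UNIV (\<lambda>x. c)"
  by (induction k arbitrary: c) auto

lemma Ck_on_bounded_linear: "bounded_linear f \<Longrightarrow> Ck_on k UNIV f"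
proof (cases k)
  case (Suc j)
  assume "bounded_linear f"
  then show ?thesis
    unfolding Suc
    by (intro Ck_on_Suc_if_has_derivative[where f' = "\<lambda>_. f"] bounded_linear_imp_has_derivative
        Ck_on_const)
qed (simp add: linear_continuous_on)

lemma Ck_on_add: "Ck_on k UNIV f \<Longrightarrow> Ck_on k UNIV g \<Longrightarrow> Ck_on k UNIV (\<lambda>x. f x + g x)"
proof (induction k arbitrary: f g)
  case (Suc k)
  show ?case
    by (rule Ck_on_Suc_if_has_derivative[OF has_derivative_add[OF
          Ck_on_Suc_has_derivative(1)[OF Suc.prems(1)] Ck_on_Suc_has_derivative(1)[OF Suc.prems(2)]]])
      (intro Suc.IH Ck_on_Suc_has_derivative Suc.prems)
qed (auto intro: continuous_on_add)

text \<open>The product rule mixes a derivative of one factor with the other factor itself, so the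
  latter is also needed at the lower order. The bracket, scaling and the matrix product are all
  instances.\<close>

lemma (in bounded_bilinear) Ck_on_prod:
  "Ck_on k UNIV f \<Longrightarrow> Ck_on k UNIV g \<Longrightarrow> Ck_on k UNIV (\<lambda>x. prod (f x) (g x))"
proof (induction k arbitrary: f g)
  case (Suc k)
  note f = Suc.prems(1) and g = Suc.prems(2)
  show ?case
    by (rule Ck_on_Suc_if_has_derivative[OF FDERIV[OF Ck_on_Suc_has_derivative(1)[OF f]
          Ck_on_Suc_has_derivative(1)[OF g]]])
      (intro Ck_on_add Suc.IH Ck_on_Suc_has_derivative(2)[OF f] Ck_on_Suc_has_derivative(2)[OF g]
        Ck_on_Suc_imp_Ck_on[OF f] Ck_on_Suc_imp_Ck_on[OF g])
qed (auto intro: continuous_on)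

lemma smooth_on_const: "smooth_on UNIV (\<lambda>x. c)"
  and smooth_on_bounded_linear: "bounded_linear h \<Longrightarrow> smooth_on UNIV h"
  and smooth_on_add: "smooth_on UNIV f \<Longrightarrow> smooth_on UNIV g \<Longrightarrow> smooth_on UNIV (\<lambda>x. f x + g x)"
  by (simp_all add: smooth_on_def Ck_on_const Ck_on_bounded_linear Ck_on_add)

lemma (in bounded_bilinear) smooth_on_prod:
  "smooth_on UNIV f \<Longrightarrow> smooth_on UNIV g \<Longrightarrow> smooth_on UNIV (\<lambda>x. prod (f x) (g x))"
  by (simp add: smooth_on_def Ck_on_prod)


section \<open>Manifolds with a single global chart\<close>

abbreviation id_atlas :: "('a::real_normed_vector, 'a) chart set" where
  "id_atlas \<equiv> {(UNIV, id)}"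

lemma local_rep_id [simp]: "local_rep f (UNIV, id) (UNIV, id) = f"
  and local_dom_id [simp]: "local_dom f (UNIV, id) (UNIV, id) = UNIV"
  by (simp_all add: local_rep_def local_dom_def)

lemma product_id_atlas: "product_atlas id_atlas id_atlas = id_atlas"
  by (simp add: product_atlas_def map_prod.id)

lemma smooth_map_id_atlas: "smooth_map id_atlas id_atlas f \<longleftrightarrow> smooth_on UNIV f"
  by (simp add: smooth_map_def)

lemma smooth_atlas_id: "smooth_atlas UNIV id_atlas"
  using smooth_on_bounded_linear[OF bounded_linear_ident]
  by (simp add: smooth_atlas_def smooth_map_id_atlas id_def[symmetric])

lemma manifold_topology_id: "manifold_topology id_atlas = euclidean"
  by (simp add: topology_eq openin_manifold_topology[OF smooth_atlas_id])

lemma second_countable_euclidean: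
  "second_countable (euclidean :: 'a::second_countable_topology topology)"
proof -
  obtain \<B> :: "'a set set" where "countable \<B>" "\<And>C. C \<in> \<B> \<Longrightarrow> open C"
    "\<And>S. open S \<Longrightarrow> \<exists>U. U \<subseteq> \<B> \<and> S = \<Union>U"
    using univ_second_countable by blast
  then have "\<forall>U x. openin euclidean U \<and> x \<in> U \<longrightarrow> (\<exists>V\<in>\<B>. x \<in> V \<and> V \<subseteq> U)"
    by (metis Union_iff Union_upper open_openin subset_iff)
  with \<open>countable \<B>\<close> \<open>\<And>C. C \<in> \<B> \<Longrightarrow> open C\<close> show ?thesis
    unfolding second_countable_def by (intro exI[of _ \<B>]) simp
qed

lemma smooth_manifold_id:
  "smooth_manifold UNIV (id_atlas :: ('a::euclidean_space, 'a) chart set)"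
  by (simp add: smooth_manifold_def smooth_atlas_id manifold_topology_id second_countable_euclidean)

lemma connected_manifold_topology_id:
  "connected_space (manifold_topology (id_atlas :: ('a::real_normed_vector, 'a) chart set))"
  unfolding manifold_topology_id
  by (metis connected_UNIV connectedin_iff_connected connectedin_topspace topspace_euclidean)

lemma invariant_field_id:
  assumes "\<And>x. (f has_derivative f' x) (at x)"
  shows "invariant_field id_atlas f X \<longleftrightarrow>
    (\<forall>x. X (UNIV, id) (f x) = f' x (X (UNIV, id) x))"
  using frechet_derivative_at[OF assms] by (simp add: invariant_field_def)

lemma invariant_metric_id:
  assumes "\<And>x. (f has_derivative f' x) (at x)"
  shows "invariant_metric id_atlas f g \<longleftrightarrow>
    (\<forall>x u v. f' x u \<bullet> (g (UNIV, id) (f x) *v f' x v) = u \<bullet> (g (UNIV, id) x *v v))"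
  using frechet_derivative_at[OF assms] by (simp add: invariant_metric_def)

lemma smooth_vector_field_id: "smooth_vector_field id_atlas X \<longleftrightarrow> smooth_on UNIV (X (UNIV, id))"
  by (simp add: smooth_vector_field_def invariant_field_id[OF has_derivative_id])

lemma riemannian_metric_id:
  "riemannian_metric id_atlas g \<longleftrightarrow> smooth_on UNIV (g (UNIV, id)) \<and>
     (\<forall>x. transpose (g (UNIV, id) x) = g (UNIV, id) x \<and>
        (\<forall>v. v \<noteq> 0 \<longrightarrow> v \<bullet> (g (UNIV, id) x *v v) > 0))"
  by (simp add: riemannian_metric_def invariant_metric_id[OF has_derivative_id])

section \<open>Two-step nilpotent Lie groups in exponential coordinates\<close>

text \<open>The coordinates in \<open>Z\<close> span a central subspace that contains all brackets;
  this makes the Jacobi identity automatic. \<open>Z\<close> is a set of indices so that the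
  standard inner product splits along it.\<close>

locale two_step = bounded_bilinear br
  for br :: "real^'n \<Rightarrow> real^'n \<Rightarrow> real^'n::finite" +
  fixes Z :: "'n set"
  assumes alternating: "br x x = 0"
    and bracket_nth: "i \<notin> Z \<Longrightarrow> br x y $ i = 0"
    and central: "(\<And>i. i \<notin> Z \<Longrightarrow> z $ i = 0) \<Longrightarrow> br x z = 0"
begin

lemma bracket_commute: "br x y = - br y x"
  using alternating[of "x + y"] alternating[of x] alternating[of y]
  by (simp add: add_left add_right eq_neg_iff_add_eq_0 add.commute)

lemma bracket_bracket_right [simp]: "br x (br y z) = 0"
  by (simp add: central bracket_nth)

lemma bracket_bracket_left [simp]: "br (br y z) x = 0"
  using bracket_commute[of "br y z"] by simp

lemmas bracket_simps [simp] =
  add_left add_right diff_left diff_right minus_left minus_right scaleR_left scaleR_right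
  zero_left zero_right alternating

text \<open>The Baker-Campbell-Hausdorff product: the series stops here since double brackets
  vanish, and the exponential map becomes the identity chart.\<close>

definition bch :: "real^'n \<Rightarrow> real^'n \<Rightarrow> real^'n" where
  "bch x y = x + y + (1/2) *\<^sub>R br x y"

definition lie_grp :: "(real^'n) monoid" where
  "lie_grp = \<lparr>carrier = UNIV, mult = bch, one = 0\<rparr>"

text \<open>The differential at \<open>0\<close> of the left translation by \<open>x\<close>. It is also its differential at
  every other point, since left translations are affine; its inverse is \<open>transl (- x)\<close>.\<close>

definition transl :: "real^'n \<Rightarrow> real^'n \<Rightarrow> real^'n" where
  "transl x v = v + (1/2) *\<^sub>R br x v"

lemma transl_inverse [simp]: "transl x (transl (- x) v) = v" "transl (- x) (transl x v) = v"
  by (simp_all add: transl_def)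

lemma transl_bch: "transl (bch x y) v = transl x (transl y v)"
  by (simp add: transl_def bch_def algebra_simps)

lemma transl_minus_bch: "transl (- bch x y) v = transl (- y) (transl (- x) v)"
  by (simp add: transl_def bch_def algebra_simps)

lemma bracket_transl [simp]: "br (transl x u) v = br u v" "br u (transl x v) = br u v"
  by (simp_all add: transl_def)

lemma transl_0 [simp]: "transl 0 v = v"
  by (simp add: transl_def)

lemma linear_bracket: "linear (br x)"
  using bounded_linear_right[of x] by (rule bounded_linear.linear)

lemma linear_transl: "linear (transl x)"
  by (rule linearI) (simp_all add: transl_def algebra_simps)

lemma has_derivative_bch: "(bch a has_derivative transl a) (at x)"
  unfolding bch_def transl_def
  by (auto intro!: derivative_eq_intros bounded_linear_right[THEN bounded_linear_imp_has_derivative])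

lemma group_lie_grp: "group lie_grp"
proof (rule groupI)
  fix x assume "x \<in> carrier lie_grp"
  show "\<exists>y\<in>carrier lie_grp. y \<otimes>\<^bsub>lie_grp\<^esub> x = \<one>\<^bsub>lie_grp\<^esub>"
    by (rule bexI[of _ "- x"]) (simp_all add: lie_grp_def bch_def)
qed (simp_all add: lie_grp_def bch_def algebra_simps)

lemma inv_lie_grp: "inv\<^bsub>lie_grp\<^esub> x = - x"
  by (rule group.inv_equality[OF group_lie_grp]) (simp_all add: lie_grp_def bch_def)

lemma smooth_on_bracket:
  "smooth_on UNIV f \<Longrightarrow> smooth_on UNIV g \<Longrightarrow> smooth_on UNIV (\<lambda>x. br (f x) (g x))"
  by (rule smooth_on_prod)

lemma smooth_on_transl:
  assumes "smooth_on UNIV f" "smooth_on UNIV g"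
  shows "smooth_on UNIV (\<lambda>x. transl (f x) (g x))"
  unfolding transl_def
  using bounded_bilinear.smooth_on_prod[OF bounded_bilinear_scaleR smooth_on_const
      smooth_on_bracket[OF assms]] assms
  by (intro smooth_on_add) auto

lemma lie_group_lie_grp: "lie_group lie_grp id_atlas"
proof -
  have "smooth_on UNIV (\<lambda>p. fst p + transl (fst p) (snd p))"
    by (intro smooth_on_add smooth_on_transl smooth_on_bounded_linear bounded_linear_fst
        bounded_linear_snd)
  then have "smooth_on UNIV (\<lambda>(p, q). p \<otimes>\<^bsub>lie_grp\<^esub> q)"
    by (simp add: case_prod_unfold lie_grp_def bch_def transl_def add.assoc)
  moreover have "smooth_on UNIV (uminus :: real^'n \<Rightarrow> _)"
    by (intro smooth_on_bounded_linear bounded_linear_minus bounded_linear_ident)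
  moreover have "carrier lie_grp = UNIV"
    by (simp add: lie_grp_def)
  ultimately show ?thesis
    by (simp add: lie_group_def group_lie_grp smooth_manifold_id product_id_atlas
        smooth_map_id_atlas inv_lie_grp)
qed

lemma left_invariant_field_lie_grp:
  "left_invariant_field lie_grp id_atlas X \<longleftrightarrow>
     smooth_on UNIV (X (UNIV, id)) \<and>
     (\<forall>a x. X (UNIV, id) (bch a x) = transl a (X (UNIV, id) x))"
  by (simp add: left_invariant_field_def smooth_vector_field_id lie_grp_def
      invariant_field_id[OF has_derivative_bch])

text \<open>A left-invariant field is determined by its value \<open>u\<close> at \<open>0\<close>,
  and is \<open>transl x u\<close> at \<open>x\<close>. Its derivative is half a bracket, and by
  skew symmetry the two halves in \<open>lie_bracket\<close> add up to
  \<open>br u v\<close>.\<close>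

lemma is_lie_algebra_of_lie_grp: "is_lie_algebra_of lie_grp id_atlas br"
  unfolding is_lie_algebra_of_def
proof (intro exI[of _ "\<lambda>u c x. transl x u"] conjI allI ballI impI)
  fix u
  show "left_invariant_field lie_grp id_atlas (\<lambda>c x. transl x u)"
    using smooth_on_transl[OF smooth_on_bounded_linear[OF bounded_linear_ident] smooth_on_const]
    by (simp add: left_invariant_field_lie_grp transl_bch)
next
  fix x
  show "linear (\<lambda>u. transl x u)"
    by (rule linear_transl)
next
  fix X assume "left_invariant_field lie_grp id_atlas X"
  then have "X (UNIV, id) (bch x 0) = transl x (X (UNIV, id) 0)" for x
    by (simp add: left_invariant_field_lie_grp)
  moreover have "bch x 0 = x" for x
    by (simp add: bch_def)
  ultimately have X: "X (UNIV, id) x = transl x (X (UNIV, id) 0)" for x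
    by metis
  show "\<exists>!u. \<forall>c\<in>id_atlas. \<forall>x\<in>snd c ` fst c. X c x = transl x u"
  proof (rule ex1I[of _ "X (UNIV, id) 0"])
    show "\<forall>c\<in>id_atlas. \<forall>x\<in>snd c ` fst c. X c x = transl x (X (UNIV, id) 0)"
      using X by blast
    fix u assume "\<forall>c\<in>id_atlas. \<forall>x\<in>snd c ` fst c. X c x = transl x u"
    then have "X (UNIV, id) 0 = transl 0 u"
      by (simp del: transl_0)
    then show "u = X (UNIV, id) 0" by simp
  qed
next
  fix u v x
  have "((\<lambda>x. transl x u) has_derivative (\<lambda>h. (1/2) *\<^sub>R br h u)) (at x)" for u
    unfolding transl_def
    by (auto intro!: derivative_eq_intros bounded_linear_left[THEN bounded_linear_imp_has_derivative])
  then have "frechet_derivative (\<lambda>x. transl x u) (at x) = (\<lambda>h. (1/2) *\<^sub>R br h u)" for u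
    using frechet_derivative_at by metis
  then show "transl x (br u v) = lie_bracket (\<lambda>x. transl x u) (\<lambda>x. transl x v) x"
    using bracket_commute[of v u]
    by (simp add: lie_bracket_def transl_def scaleR_left_distrib[symmetric])
qed

lemma nilpotent_lie_algebra_bracket: "nilpotent_lie_algebra br"
proof -
  have "lie_algebra br"
    by (simp add: lie_algebra_def bilinear_conv_bounded_bilinear bounded_bilinear_axioms)
  moreover have "lower_central_series br 2 = {0}"
  proof -
    have "br x y = 0" if "y \<in> span {br x y |x y. y \<in> UNIV}" for x y
      using that by (induction rule: span_induct_alt) auto
    then have "{br x y |x y. y \<in> span {br x y |x y. y \<in> UNIV}} = {0}"
      using span_zero by (auto intro!: exI[of _ 0])
    then show ?thesis
      by (simp add: numeral_2_eq_2)
  qed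
  ultimately show ?thesis
    unfolding nilpotent_lie_algebra_def by blast
qed

lemma nilpotent_lie_group_lie_grp: "nilpotent_lie_group lie_grp id_atlas br"
  by (simp add: nilpotent_lie_group_def lie_group_lie_grp connected_manifold_topology_id
      is_lie_algebra_of_lie_grp nilpotent_lie_algebra_bracket)

end

section \<open>Traces of linear operators\<close>

text \<open>The trace of a map instead of a matrix, so that cyclicity applies directly to
  compositions of \<open>br\<close>, its adjoint and \<open>transl x\<close>.\<close>

definition op_trace :: "(real^'n \<Rightarrow> real^'n::finite) \<Rightarrow> real" where
  "op_trace f = (\<Sum>i\<in>UNIV. f (axis i 1) $ i)"

lemma linear_nth_expand:
  fixes f :: "real^'n \<Rightarrow> real^'m"
  assumes "linear f"
  shows "f x $ j = (\<Sum>i\<in>UNIV. x $ i * f (axis i 1) $ j)"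
  using linear_componentwise[of f x j] assms by (simp add: linear_matrix_vector_mul_eq)

lemma op_trace_commute:
  assumes "linear f" "linear g"
  shows "op_trace (\<lambda>x. f (g x)) = op_trace (\<lambda>x. g (f x))"
proof -
  have "op_trace (\<lambda>x. f (g x)) = (\<Sum>i\<in>UNIV. \<Sum>j\<in>UNIV. g (axis i 1) $ j * f (axis j 1) $ i)"
    unfolding op_trace_def by (subst linear_nth_expand[OF assms(1)]) simp
  also have "\<dots> = (\<Sum>j\<in>UNIV. \<Sum>i\<in>UNIV. f (axis j 1) $ i * g (axis i 1) $ j)"
    by (subst sum.swap) (simp add: mult.commute)
  also have "\<dots> = op_trace (\<lambda>x. g (f x))"
    unfolding op_trace_def by (subst (2) linear_nth_expand[OF assms(2)]) simp
  finally show ?thesis .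
qed

lemma op_trace_add: "op_trace (\<lambda>x. f x + g x) = op_trace f + op_trace g"
  and op_trace_minus: "op_trace (\<lambda>x. - f x) = - op_trace f"
  and op_trace_scaleR: "op_trace (\<lambda>x. c *\<^sub>R f x) = c * op_trace f"
  and op_trace_zero: "op_trace (\<lambda>x. 0) = 0"
  by (simp_all add: op_trace_def sum.distrib sum_negf sum_distrib_left)

lemma op_trace_inner: "op_trace f = (\<Sum>i\<in>UNIV. f (axis i 1) \<bullet> axis i 1)"
  by (simp add: op_trace_def inner_axis)

lemma matrix_inv_eq:
  fixes A B :: "'a::field^'n^'n"
  assumes "A ** B = mat 1"
  shows "matrix_inv A = B"
proof -
  have "B ** A = mat 1"
    using assms by (simp add: matrix_left_right_inverse)
  then have "A ** matrix_inv A = mat 1 \<and> matrix_inv A ** A = mat 1"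
    unfolding matrix_inv_def using assms by (intro someI) blast
  then show ?thesis
    by (metis \<open>B ** A = mat 1\<close> matrix_mul_assoc matrix_mul_lid matrix_mul_rid)
qed


section \<open>The curvature of a two-step nilpotent Lie group\<close>

lemma partial_eqI: "(f has_derivative f') (at x) \<Longrightarrow> partial i f x = f' (axis i 1)"
  unfolding partial_def using frechet_derivative_at by metis

context two_step
begin

text \<open>The standard inner product at \<open>0\<close>, carried to \<open>x\<close> by left
  translation: \<open>transl (- x)\<close> is the differential of the translation that moves
  \<open>x\<close> back to \<open>0\<close>.\<close>

definition metric :: "real^'n \<Rightarrow> real^'n^'n" where
  "metric x = transpose (matrix (transl (- x))) ** matrix (transl (- x))"

lemma inner_metric: "u \<bullet> (metric x *v v) = transl (- x) u \<bullet> transl (- x) v"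
  using dot_lmul_matrix[of "transl (- x) v" "matrix (transl (- x))" u]
  by (simp add: metric_def matrix_vector_mul_assoc[symmetric] matrix_works linear_transl inner_commute
      linear_matrix_vector_mul_eq)

lemma metric_nth: "metric x $ i $ j = transl (- x) (axis i 1) \<bullet> transl (- x) (axis j 1)"
  using inner_metric[of "axis i 1" x "axis j 1"]
  by (simp add: inner_axis' matrix_vector_mul_component inner_axis)

lemma smooth_metric: "smooth_on UNIV metric"
proof -
  have "bounded_linear (\<lambda>x. matrix (\<lambda>v. (-1/2) *\<^sub>R br x v))"
    unfolding linear_conv_bounded_linear[symmetric]
    by (rule linearI) (simp_all add: matrix_def vec_eq_iff algebra_simps)
  then have "smooth_on UNIV (\<lambda>x. mat 1 + matrix (\<lambda>v. (-1/2) *\<^sub>R br x v))"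
    by (intro smooth_on_add smooth_on_const smooth_on_bounded_linear)
  also have "(\<lambda>x. mat 1 + matrix (\<lambda>v. (-1/2) *\<^sub>R br x v)) = (\<lambda>x. matrix (transl (- x)))"
    by (auto simp: fun_eq_iff matrix_def vec_eq_iff transl_def mat_def axis_def)
  finally have *: "smooth_on UNIV (\<lambda>x. matrix (transl (- x)))" .
  have "bounded_bilinear (\<lambda>A B. transpose A ** B :: real^'n^'n)"
    unfolding bilinear_conv_bounded_bilinear[symmetric] bilinear_def
    by (intro conjI allI linearI)
      (simp_all add: matrix_matrix_mult_def transpose_def vec_eq_iff sum.distrib sum_distrib_left algebra_simps)
  from bounded_bilinear.smooth_on_prod[OF this * *] show ?thesis
    by (simp add: metric_def[abs_def])
qed

lemma riemannian_metric_lie_grp: "riemannian_metric id_atlas (\<lambda>c. metric)"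
  unfolding riemannian_metric_id
proof (intro conjI allI impI)
  fix x v :: "real^'n" assume "v \<noteq> 0"
  then have "transl (- x) v \<noteq> 0"
    by (metis transl_inverse(1) linear_transl linear_0)
  then show "v \<bullet> (metric x *v v) > 0"
    by (simp add: inner_metric)
qed (simp_all add: smooth_metric metric_def matrix_transpose_mul)

lemma left_invariant_metric_lie_grp: "left_invariant_metric lie_grp id_atlas (\<lambda>c. metric)"
  by (simp add: left_invariant_metric_def riemannian_metric_lie_grp lie_grp_def
      invariant_metric_id[OF has_derivative_bch] inner_metric transl_minus_bch)

section \<open>The adjoint of the bracket and the Christoffel symbols\<close>

definition coad :: "real^'n \<Rightarrow> real^'n \<Rightarrow> real^'n" where
  "coad u w = adjoint (br u) w"

text \<open>In the usual notation for two-step nilpotent groups, \<open>coad u w\<close> is J_w u,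
  where J_w is the skew map that represents the form \<open>br u v \<bullet> w\<close>.\<close>

lemma inner_coad: "v \<bullet> coad u w = br u v \<bullet> w" "coad u w \<bullet> v = br u v \<bullet> w"
  using adjoint_works[OF linear_bracket] by (simp_all add: coad_def inner_commute)

lemma coad_simps [simp]:
  "coad u (v + w) = coad u v + coad u w" "coad (u + v) w = coad u w + coad v w"
  "coad u (v - w) = coad u v - coad u w" "coad (u - v) w = coad u w - coad v w"
  "coad (c *\<^sub>R u) w = c *\<^sub>R coad u w" "coad u (c *\<^sub>R w) = c *\<^sub>R coad u w"
  "coad (- u) w = - coad u w" "coad u (- w) = - coad u w"
  "coad (br u v) w = 0" "coad u (coad v w) = 0" "coad (transl u v) w = coad v w"
  by (rule iffD1[OF vector_eq_ldot], simp add: inner_coad inner_simps transl_def)+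

lemma linear_coad: "linear (coad u)" "linear (\<lambda>u. coad u w)"
  by (auto intro!: linearI)

lemma op_trace_bracket: "op_trace (br u) = 0"
  unfolding op_trace_def
proof (intro sum.neutral ballI)
  fix i
  show "br u (axis i 1) $ i = 0"
  proof (cases "i \<in> Z")
    case True
    then have "br u (axis i 1) = 0"
      by (intro central) (auto simp: axis_def)
    then show ?thesis by simp
  qed (simp add: bracket_nth)
qed

lemma op_trace_coad: "op_trace (coad u) = 0" "op_trace (\<lambda>u. coad u w) = 0"
  using op_trace_bracket[of u] by (simp_all add: op_trace_inner inner_coad inner_commute)

text \<open>The Levi-Civita connection in the left-invariant frame, without its skew part.\<close>

definition conn :: "real^'n \<Rightarrow> real^'n \<Rightarrow> real^'n" where
  "conn a b = (-1/2) *\<^sub>R (coad a b + coad b a)"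

text \<open>Christoffel symbols as a bilinear map. The skew part
  \<open>(1/2) *\<^sub>R br a b\<close> of the connection is cancelled by the derivative of the
  left-invariant frame, so only \<open>conn\<close> remains, carried from \<open>0\<close> to
  \<open>x\<close>.\<close>

definition chris :: "real^'n \<Rightarrow> real^'n \<Rightarrow> real^'n \<Rightarrow> real^'n" where
  "chris x u v = transl x (conn (transl (- x) u) (transl (- x) v))"

lemma has_derivative_transl_minus:
  "((\<lambda>x. transl (- x) v) has_derivative (\<lambda>h. (-1/2) *\<^sub>R br h v)) (at x)"
  unfolding transl_def
  by (auto intro!: derivative_eq_intros bounded_linear_left[THEN bounded_linear_imp_has_derivative])

lemma has_derivative_metric:
  "((\<lambda>x. metric x $ i $ j) has_derivative (\<lambda>h.
     - (br h (axis i 1) \<bullet> transl (- x) (axis j 1) + transl (- x) (axis i 1) \<bullet> br h (axis j 1)) / 2)) (at x)"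
  unfolding metric_nth
  by (rule has_derivative_eq_rhs[OF has_derivative_inner[OF has_derivative_transl_minus
          has_derivative_transl_minus]]) (auto simp: field_simps)

lemma matrix_inv_metric:
  "matrix_inv (metric x) = matrix (transl x) ** transpose (matrix (transl x))"
proof (rule matrix_inv_eq)
  have 1: "matrix (transl (- x)) ** matrix (transl x) = mat 1"
    by (simp add: matrix_compose[symmetric, OF linear_transl linear_transl] o_def
        matrix_id_mat_1[unfolded id_def])
  then have 2: "transpose (matrix (transl (- x))) ** transpose (matrix (transl x)) = mat 1"
    by (metis matrix_left_right_inverse matrix_transpose_mul transpose_mat)
  show "metric x ** (matrix (transl x) ** transpose (matrix (transl x))) = mat 1"
    unfolding metric_def using 1 2 by (metis matrix_mul_assoc matrix_mul_lid)
qed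

text \<open>The Koszul formula: half the combination of derivatives pairs \<open>?U\<close> with the
  translated basis vectors, and raising the index with the inverse metric carries \<open>?U\<close>
  to the point \<open>x\<close>.\<close>

lemma christoffel_metric: "christoffel metric k i j x = chris x (axis i 1) (axis j 1) $ k"
proof -
  let ?M = "transl (- x)" and ?e = "\<lambda>i. axis i 1 :: real^'n"
  let ?U = "conn (?M (?e i)) (?M (?e j))"
  have "(partial i (\<lambda>y. metric y $ j $ l) x + partial j (\<lambda>y. metric y $ i $ l) x
          - partial l (\<lambda>y. metric y $ i $ j) x) / 2 = ?U \<bullet> ?M (?e l)" for l
    using bracket_commute[of "?e j" "?e i"] bracket_commute[of "?e l" "?e i"]
      bracket_commute[of "?e l" "?e j"]
    by (simp add: partial_eqI[OF has_derivative_metric] conn_def inner_coad inner_add_left)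
      (simp add: inner_commute field_simps)
  then have "christoffel metric k i j x =
      (\<Sum>l\<in>UNIV. matrix_inv (metric x) $ k $ l * (?U \<bullet> ?M (?e l)))"
    unfolding christoffel_def sum_divide_distrib by (simp flip: times_divide_eq_right)
  also have "\<dots> = (matrix_inv (metric x) *v (transpose (matrix ?M) *v ?U)) $ k"
  proof -
    have "?U \<bullet> ?M (?e l) = (?U v* matrix ?M) \<bullet> ?e l" for l
      by (simp add: dot_lmul_matrix matrix_works linear_transl linear_matrix_vector_mul_eq)
    then have "?U \<bullet> ?M (?e l) = (transpose (matrix ?M) *v ?U) $ l" for l
      by (simp add: inner_axis)
    then show ?thesis
      by (simp add: matrix_vector_mult_def)
  qed
  also have "matrix_inv (metric x) *v (transpose (matrix ?M) *v ?U) = transl x ?U"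
  proof -
    have "matrix ?M ** matrix (transl x) = mat 1"
      by (simp add: matrix_compose[symmetric, OF linear_transl linear_transl] o_def
          matrix_id_mat_1[unfolded id_def])
    then have "transpose (matrix (transl x)) ** transpose (matrix ?M) = mat 1"
      by (metis matrix_transpose_mul transpose_mat)
    then have "matrix_inv (metric x) *v (transpose (matrix ?M) *v ?U) = matrix (transl x) *v ?U"
      unfolding matrix_inv_metric
      by (metis matrix_mul_assoc matrix_mul_rid matrix_vector_mul_assoc)
    then show ?thesis
      by (simp add: matrix_works linear_transl)
  qed
  finally show ?thesis
    by (simp add: chris_def)
qed


lemma linear_conn: "linear (conn a)"
  unfolding conn_def by (auto intro!: linearI simp: algebra_simps)

lemma conn_commute: "conn a b = conn b a"
  by (simp add: conn_def add.commute)

lemma linear_chris: "linear (chris x u)"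
  unfolding chris_def
  using linear_compose[OF linear_compose[OF linear_transl linear_conn] linear_transl]
  by (simp add: o_def)

lemma chris_commute: "chris x u v = chris x v u"
  by (simp add: chris_def conn_commute)

text \<open>The directional derivative of \<open>conn (transl (- x) u) (transl (- x) v)\<close>, which is affine in
  \<open>x\<close> because \<open>coad (transl (- x) u) = coad u\<close>.\<close>

definition dconn :: "real^'n \<Rightarrow> real^'n \<Rightarrow> real^'n \<Rightarrow> real^'n" where
  "dconn u v w = (1/4) *\<^sub>R (coad u (br w v) + coad v (br w u))"

definition dchris :: "real^'n \<Rightarrow> real^'n \<Rightarrow> real^'n \<Rightarrow> real^'n \<Rightarrow> real^'n" where
  "dchris x u v w = dconn u v w +
     (1/2) *\<^sub>R (br w (conn (transl (- x) u) (transl (- x) v)) + br x (dconn u v w))"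

lemma bounded_linear_dconn: "bounded_linear (dconn u v)"
  unfolding linear_conv_bounded_linear[symmetric] dconn_def
  by (auto intro!: linearI simp: algebra_simps)

lemma has_derivative_conn_transl:
  "((\<lambda>x. conn (transl (- x) u) (transl (- x) v)) has_derivative dconn u v) (at x)"
proof -
  have "conn (transl (- x) u) (transl (- x) v) = conn u v + dconn u v x" for x
    by (simp add: conn_def dconn_def transl_def algebra_simps)
  then show ?thesis
    by (auto intro!: derivative_eq_intros bounded_linear_imp_has_derivative[OF bounded_linear_dconn])
qed

lemma has_derivative_chris: "((\<lambda>x. chris x u v) has_derivative dchris x u v) (at x)"
  unfolding chris_def dchris_def
  by (subst transl_def)
    (rule has_derivative_eq_rhs[OF has_derivative_add[OF has_derivative_conn_transl
        has_derivative_scaleR_right[OF FDERIV[OF has_derivative_ident has_derivative_conn_transl]]]],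
      simp add: fun_eq_iff algebra_simps)

lemma partial_christoffel:
  "partial l (christoffel metric k i j) x = dchris x (axis i 1) (axis j 1) (axis l 1) $ k"
proof -
  have "christoffel metric k i j = (\<lambda>x. chris x (axis i 1) (axis j 1) $ k)"
    by (simp add: fun_eq_iff christoffel_metric)
  then show ?thesis
    using partial_eqI[OF bounded_linear.has_derivative[OF bounded_linear_vec_nth has_derivative_chris]]
    by simp
qed

section \<open>Traces in the Ricci tensor\<close>

lemma op_trace_conj: "linear f \<Longrightarrow> op_trace (\<lambda>w. transl x (f (transl (- x) w))) = op_trace f"
  using op_trace_commute[of "transl x" "\<lambda>w. f (transl (- x) w)"]
    linear_compose[OF linear_transl[of "- x"], of f]
  by (simp add: linear_transl o_def)

text \<open>Geometrically, \<open>transl x\<close> is unipotent, so the Riemannian volume density is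
  constant and the contracted Christoffel symbols vanish.\<close>

lemma op_trace_chris: "op_trace (chris x u) = 0"
proof -
  have "op_trace (chris x u) = op_trace (conn (transl (- x) u))"
    unfolding chris_def by (rule op_trace_conj[OF linear_conn])
  also have "\<dots> = 0"
    unfolding conn_def by (simp add: op_trace_minus op_trace_scaleR op_trace_add op_trace_coad)
  finally show ?thesis .
qed

lemma sum_dchris_eq_0: "(\<Sum>k\<in>UNIV. dchris x u (axis k 1) w $ k) = 0"
proof -
  have "((\<lambda>x. \<Sum>k\<in>UNIV. chris x u (axis k 1) $ k) has_derivative
      (\<lambda>w. \<Sum>k\<in>UNIV. dchris x u (axis k 1) w $ k)) (at x)"
    by (intro has_derivative_sum bounded_linear.has_derivative[OF bounded_linear_vec_nth]
        has_derivative_chris)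
  moreover have "(\<lambda>x. \<Sum>k\<in>UNIV. chris x u (axis k 1) $ k) = (\<lambda>x. 0)"
    using op_trace_chris by (simp add: op_trace_def)
  ultimately have "((\<lambda>x. 0) has_derivative (\<lambda>w. \<Sum>k\<in>UNIV. dchris x u (axis k 1) w $ k)) (at x)"
    by simp
  then have "(\<lambda>w. \<Sum>k\<in>UNIV. dchris x u (axis k 1) w $ k) = (\<lambda>w. 0)"
    using has_derivative_unique has_derivative_const by blast
  then show ?thesis by metis
qed

lemma op_trace_coad_bracket:
  "op_trace (\<lambda>w. coad u (br w v)) = - (\<Sum>k\<in>UNIV. br u (axis k 1) \<bullet> br v (axis k 1))"
proof -
  have "br w v = - br v w" for w
    by (rule bracket_commute)
  then show ?thesis
    by (simp add: op_trace_inner inner_coad sum_negf)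
qed

lemma op_trace_bracket_left: "op_trace (\<lambda>w. br w v) = 0"
proof -
  have "br w v = - br v w" for w
    by (rule bracket_commute)
  then show ?thesis
    using op_trace_bracket[of v] by (simp add: op_trace_minus)
qed

text \<open>Cyclicity moves the outer bracket inside the inner one, where it is a double
  bracket.\<close>

lemma op_trace_bracket_coad_bracket: "op_trace (\<lambda>w. br x (coad u (br w v))) = 0"
proof -
  have lin: "linear (\<lambda>w. br w v)"
    using bounded_linear_left by (rule bounded_linear.linear)
  have lin2: "linear (\<lambda>w. br x (coad u w))"
    using linear_compose[OF linear_coad(1) linear_bracket] by (simp add: o_def)
  show ?thesis
    using op_trace_commute[OF lin2 lin] by (simp add: op_trace_zero)
qed

lemma op_trace_dchris:
  "op_trace (dchris x u v) = - (\<Sum>k\<in>UNIV. br u (axis k 1) \<bullet> br v (axis k 1)) / 2"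
proof -
  have "op_trace (dconn u v) = - (\<Sum>k\<in>UNIV. br u (axis k 1) \<bullet> br v (axis k 1)) / 2"
    unfolding dconn_def
    by (simp add: op_trace_scaleR op_trace_add op_trace_coad_bracket inner_commute)
  moreover have "op_trace (\<lambda>w. br x (dconn u v w)) = 0"
    unfolding dconn_def
    by (simp add: op_trace_scaleR op_trace_add op_trace_bracket_coad_bracket)
  ultimately show ?thesis
    unfolding dchris_def
    by (simp add: op_trace_scaleR op_trace_add op_trace_bracket_left)
qed

text \<open>With J_a w written for \<open>coad w a\<close>, the product J_b J_a is the only
  contribution that survives the two-step condition. Its trace is minus the Hilbert-Schmidt product
  of J_a and J_b, by skewness.\<close>

lemma op_trace_conn_conn:
  "op_trace (\<lambda>w. conn b (conn a w)) =
     - (\<Sum>k\<in>UNIV. \<Sum>l\<in>UNIV.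
          (a \<bullet> br (axis k 1) (axis l 1)) * (b \<bullet> br (axis k 1) (axis l 1))) / 4"
proof -
  have coad_T: "op_trace (\<lambda>w. coad u (coad w c)) = 0" for u c
  proof -
    have "br (axis k 1) (br u (axis k 1)) \<bullet> c = 0" for k :: 'n
      by simp
    then show ?thesis
      by (simp add: op_trace_inner inner_coad)
  qed
  have T_coad: "op_trace (\<lambda>w. coad (coad u w) c) = 0" for u c
    using op_trace_commute[OF linear_coad(2)[of c] linear_coad(1)[of u]] coad_T[of u c] by simp
  have "op_trace (\<lambda>w. coad (coad w a) b) =
      - (\<Sum>k\<in>UNIV. coad (axis k 1) b \<bullet> coad (axis k 1) a)"
  proof -
    have "coad (coad e a) b \<bullet> e = - (coad e b \<bullet> coad e a)" for e
      unfolding inner_coad(2)[of "coad e a" b e] inner_coad(2)[of e b "coad e a"]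
      using bracket_commute[of "coad e a" e] by simp
    then show ?thesis
      by (simp add: op_trace_inner sum_negf)
  qed
  also have "\<dots> = - (\<Sum>k\<in>UNIV. \<Sum>l\<in>UNIV.
      (a \<bullet> br (axis k 1) (axis l 1)) * (b \<bullet> br (axis k 1) (axis l 1)))"
  proof -
    have "coad e c $ l = c \<bullet> br e (axis l 1)" for e c l
      using inner_coad(1)[of "axis l 1" e c] by (simp add: inner_axis' inner_commute)
    then show ?thesis
      by (simp add: inner_vec_def[of "coad _ _"] mult.commute)
  qed
  finally show ?thesis
    unfolding conn_def
    by (simp add: op_trace_scaleR op_trace_add coad_T T_coad op_trace_zero)
qed

lemma op_trace_chris_chris:
  "op_trace (\<lambda>w. chris x v (chris x u w)) =
     - (\<Sum>k\<in>UNIV. \<Sum>l\<in>UNIV. (transl (- x) u \<bullet> br (axis k 1) (axis l 1)) *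
          (transl (- x) v \<bullet> br (axis k 1) (axis l 1))) / 4"
  using op_trace_conj[OF linear_compose[OF linear_conn linear_conn]]
  by (simp add: chris_def o_def op_trace_conn_conn)

text \<open>Two of the four contractions in \<open>ricci\<close> contain the trace of a Christoffel
  operator and vanish. The divergence yields the last sum and the remaining quadratic one the first.
  The last sum needs no \<open>transl (- x)\<close>, because brackets do not see central
  components.\<close>

theorem ricci_metric:
  "ricci metric i j x =
     (\<Sum>k\<in>UNIV. \<Sum>l\<in>UNIV. (transl (- x) (axis i 1) \<bullet> br (axis k 1) (axis l 1)) *
          (transl (- x) (axis j 1) \<bullet> br (axis k 1) (axis l 1))) / 4
     - (\<Sum>k\<in>UNIV. br (axis i 1) (axis k 1) \<bullet> br (axis j 1) (axis k 1)) / 2"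
proof -
  let ?e = "\<lambda>i. axis i 1 :: real^'n"
  have "(\<Sum>k\<in>UNIV. \<Sum>l\<in>UNIV. chris x (?e k) (?e l) $ k * chris x (?e i) (?e j) $ l) =
      (\<Sum>l\<in>UNIV. op_trace (chris x (?e l)) * chris x (?e i) (?e j) $ l)"
    unfolding op_trace_def sum_distrib_right
    by (subst sum.swap) (simp add: chris_commute[of x "?e _" "?e _"])
  then have 1: "(\<Sum>k\<in>UNIV. \<Sum>l\<in>UNIV. chris x (?e k) (?e l) $ k * chris x (?e i) (?e j) $ l) = 0"
    by (simp add: op_trace_chris)
  have 2: "(\<Sum>k\<in>UNIV. \<Sum>l\<in>UNIV. chris x (?e j) (?e l) $ k * chris x (?e i) (?e k) $ l) =
      op_trace (\<lambda>w. chris x (?e j) (chris x (?e i) w))"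
    unfolding op_trace_def
    by (subst (3) linear_nth_expand[OF linear_chris]) (simp add: mult.commute)
  show ?thesis
    using op_trace_dchris[of x "?e i" "?e j"]
    by (simp add: ricci_def partial_christoffel christoffel_metric sum_subtractf
        sum_dchris_eq_0 1 2 op_trace_chris_chris) (simp add: op_trace_def)
qed


section \<open>The grading derivation and the soliton equation\<close>

definition grade :: "real^'n \<Rightarrow> real^'n" where
  "grade x = (\<chi> i. (if i \<in> Z then 2 else 1) * x $ i)"

lemma bounded_linear_grade: "bounded_linear grade"
  unfolding linear_conv_bounded_linear[symmetric] grade_def
  by (auto intro!: linearI simp: vec_eq_iff algebra_simps)

lemma bracket_grade [simp]: "br (grade x) y = br x y"
proof -
  have "br y (grade x - x) = 0"
    by (rule central) (simp add: grade_def)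
  then show ?thesis
    using bracket_commute[of "grade x" y] bracket_commute[of x y] by simp
qed

lemma grade_bracket: "grade (br x y) = 2 *\<^sub>R br x y"
  by (simp add: grade_def vec_eq_iff bracket_nth)

lemma grade_transl: "grade (transl (- x) u) = transl (- x) (grade u) - (1/2) *\<^sub>R br x u"
proof -
  have "br x (grade u) = br x u"
    using bracket_commute[of x "grade u"] bracket_commute[of x u] by simp
  then show ?thesis
    using bounded_linear.linear[OF bounded_linear_grade]
    by (simp add: transl_def linear_diff linear_cmul grade_bracket scaleR_left_distrib[symmetric])
qed

lemma inner_grade_commute: "grade u \<bullet> v = u \<bullet> grade v"
  unfolding inner_vec_def by (intro sum.cong refl) (simp add: grade_def)

text \<open>The flow of the field consists of group automorphisms, the dilations of the grading.
  They act on left-invariant metrics through their differential at \<open>0\<close>, so the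
  derivative is left-invariant again and given by the symmetric map \<open>grade\<close>.\<close>

lemma lie_derivative_metric_grade:
  "lie_derivative_metric (\<lambda>x. d *\<^sub>R grade x) metric i j x =
     2 * d * (grade (transl (- x) (axis i 1)) \<bullet> transl (- x) (axis j 1))"
proof -
  let ?e = "\<lambda>i. axis i 1 :: real^'n" and ?M = "transl (- x)"
  have grade_der: "partial l (\<lambda>y. (d *\<^sub>R grade y) $ k) x = d * grade (?e l) $ k" for k l
    by (rule partial_eqI[THEN trans], (rule bounded_linear.has_derivative[OF bounded_linear_vec_nth]
          bounded_linear_imp_has_derivative bounded_linear_scaleR_right[THEN bounded_linear_compose]
          bounded_linear_grade)+) simp
  have lin: "f u = (\<Sum>k\<in>UNIV. u $ k * f (?e k))" if "linear f" for f :: "real^'n \<Rightarrow> real" and u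
  proof -
    have "f u = f (\<Sum>k\<in>UNIV. u $ k *\<^sub>R ?e k)"
      using basis_expansion[of u] by (simp add: scalar_mult_eq_scaleR)
    then show ?thesis
      using that by (simp add: linear_sum linear_cmul)
  qed
  have "(\<Sum>k\<in>UNIV. (d *\<^sub>R grade x) $ k * partial k (\<lambda>y. metric y $ i $ j) x) =
      - (br (d *\<^sub>R grade x) (?e i) \<bullet> ?M (?e j) + ?M (?e i) \<bullet> br (d *\<^sub>R grade x) (?e j)) / 2"
    unfolding partial_eqI[OF has_derivative_metric]
    by (rule lin[symmetric], rule bounded_linear.linear, rule has_derivative_bounded_linear,
        rule has_derivative_metric)
  moreover have "(\<Sum>k\<in>UNIV. metric x $ k $ j * (d * grade (?e i) $ k)) =
      d * (?M (grade (?e i)) \<bullet> ?M (?e j))"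
  proof -
    have "linear (\<lambda>u. ?M u \<bullet> ?M (?e j))"
      using linear_transl[of "- x"] by (auto intro!: linearI simp: linear_add linear_cmul inner_simps)
    from lin[OF this, of "grade (?e i)"] show ?thesis
      by (simp add: metric_nth sum_distrib_left mult_ac)
  qed
  moreover have "(\<Sum>k\<in>UNIV. metric x $ i $ k * (d * grade (?e j) $ k)) =
      d * (?M (?e i) \<bullet> ?M (grade (?e j)))"
  proof -
    have "linear (\<lambda>u. ?M (?e i) \<bullet> ?M u)"
      using linear_transl[of "- x"] by (auto intro!: linearI simp: linear_add linear_cmul inner_simps)
    from lin[OF this, of "grade (?e j)"] show ?thesis
      by (simp add: metric_nth sum_distrib_left mult_ac)
  qed
  \<comment> \<open>The derivative of the metric along the field supplies exactly the bracket terms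
    by which \<open>grade\<close> fails to commute with \<open>transl (- x)\<close>.\<close>
  ultimately have "lie_derivative_metric (\<lambda>x. d *\<^sub>R grade x) metric i j x =
      d * (grade (?M (?e i)) \<bullet> ?M (?e j) + ?M (?e i) \<bullet> grade (?M (?e j)))"
    unfolding lie_derivative_metric_def grade_der sum.distrib grade_transl
    by (simp add: inner_simps algebra_simps)
  then show ?thesis
    by (simp add: inner_grade_commute[symmetric])
qed

theorem ricci_soliton_lie_grp:
  assumes c\<^sub>1: "\<And>u v. (\<Sum>k\<in>UNIV. br u (axis k 1) \<bullet> br v (axis k 1)) = c\<^sub>1 * (\<Sum>i\<in>-Z. u $ i * v $ i)"
    and c\<^sub>2: "\<And>u v. (\<Sum>k\<in>UNIV. \<Sum>l\<in>UNIV. (u \<bullet> br (axis k 1) (axis l 1)) *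
        (v \<bullet> br (axis k 1) (axis l 1))) = c\<^sub>2 * (\<Sum>i\<in>Z. u $ i * v $ i)"
  shows "ricci_soliton id_atlas (\<lambda>c. metric)"
  unfolding ricci_soliton_def
\<comment> \<open>With soliton constant k and factor d in front of \<open>grade\<close>, comparing
  coefficients outside \<open>Z\<close> and on \<open>Z\<close> gives
  \<open>- c\<^sub>1 / 2 = k + 2 * d\<close> and \<open>c\<^sub>2 / 4 = k + 4 * d\<close>; these are
  the solutions.\<close>
proof (intro conjI exI[of _ "- c\<^sub>1 - c\<^sub>2 / 4"] exI[of _ "\<lambda>c x. (c\<^sub>2 / 8 + c\<^sub>1 / 4) *\<^sub>R grade x"] ballI allI)
  show "smooth_vector_field id_atlas (\<lambda>c x. (c\<^sub>2 / 8 + c\<^sub>1 / 4) *\<^sub>R grade x)"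
    unfolding smooth_vector_field_id
    by (intro smooth_on_bounded_linear bounded_linear_scaleR_right[THEN bounded_linear_compose]
        bounded_linear_grade)
  fix x :: "real^'n" and i j
  let ?u = "transl (- x) (axis i 1)" and ?v = "transl (- x) (axis j 1)"
  have split: "sum f UNIV = sum f (- Z) + sum f Z" for f :: "'n \<Rightarrow> real"
    using sum.Int_Diff[of UNIV f Z] by (simp add: Compl_eq_Diff_UNIV)
  have "ricci metric i j x = c\<^sub>2 * (\<Sum>i\<in>Z. ?u $ i * ?v $ i) / 4 - c\<^sub>1 * (\<Sum>i\<in>-Z. ?u $ i * ?v $ i) / 2"
    using c\<^sub>1[of ?u ?v] by (simp add: ricci_metric c\<^sub>2)
  moreover have "metric x $ i $ j = (\<Sum>i\<in>-Z. ?u $ i * ?v $ i) + (\<Sum>i\<in>Z. ?u $ i * ?v $ i)"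
    by (simp add: metric_nth inner_vec_def split)
  moreover have "grade ?u \<bullet> ?v = (\<Sum>i\<in>-Z. ?u $ i * ?v $ i) + 2 * (\<Sum>i\<in>Z. ?u $ i * ?v $ i)"
    by (simp add: inner_vec_def split grade_def sum_distrib_left mult.assoc)
  ultimately show "ricci metric i j x = (- c\<^sub>1 - c\<^sub>2 / 4) * metric x $ i $ j +
      lie_derivative_metric (\<lambda>x. (c\<^sub>2 / 8 + c\<^sub>1 / 4) *\<^sub>R grade x) metric i j x"
    by (simp add: lie_derivative_metric_grade field_simps)
qed (rule riemannian_metric_lie_grp)

end

section \<open>Orbits of block triangular groups on \<open>GL(n)/O(n)\<close>\<close>

lemma l_coset_GL: "m <#\<^bsub>GL\<^esub> q = (\<lambda>x. m ** x) ` q"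
  by (auto simp: l_coset_def GL_def)

lemma GL_mod_O_eq: "GL_mod_O = {m <#\<^bsub>GL\<^esub> O_n | m. invertible m}"
  by (auto simp: GL_mod_O_def LCOSETS_def GL_def)

lemma GL_orbit_eq: "GL_orbit H p = (\<lambda>h. h <#\<^bsub>GL\<^esub> p) ` H"
  by (auto simp: GL_orbit_def orbit_def)

lemma l_coset_GL_assoc: "a <#\<^bsub>GL\<^esub> (b <#\<^bsub>GL\<^esub> q) = (a ** b) <#\<^bsub>GL\<^esub> q"
  by (simp add: l_coset_GL image_image matrix_mul_assoc)

lemma l_coset_O_n:
  assumes "orthogonal_matrix k"
  shows "(m ** k) <#\<^bsub>GL\<^esub> O_n = m <#\<^bsub>GL\<^esub> O_n"
proof -
  have "(\<lambda>x. k ** x) ` O_n = O_n"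
  proof (intro equalityI subsetI)
    fix x assume "x \<in> (O_n :: (real^'a^'a) set)"
    then have "x = k ** (transpose k ** x)" "transpose k ** x \<in> O_n"
      using assms
      by (auto simp: O_n_def matrix_mul_assoc orthogonal_matrix_mul orthogonal_matrix_transpose)
        (simp add: orthogonal_matrix_def)
    then show "x \<in> (\<lambda>x. k ** x) ` O_n" by blast
  qed (use assms in \<open>auto simp: O_n_def orthogonal_matrix_mul\<close>)
  then have "k <#\<^bsub>GL\<^esub> O_n = O_n"
    by (simp add: l_coset_GL)
  then show ?thesis
    by (metis l_coset_GL_assoc)
qed

lemma invertible_mat_1: "invertible (mat 1 :: real^'n^'n::finite)"
  unfolding invertible_def by (intro exI[of _ "mat 1"]) simp

lemma group_GL: "group (GL :: (real^'n^'n::finite) monoid)"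
proof (rule groupI)
  fix x :: "real^'n^'n" assume "x \<in> carrier GL"
  then show "\<exists>y\<in>carrier GL. y \<otimes>\<^bsub>GL\<^esub> x = \<one>\<^bsub>GL\<^esub>"
    unfolding GL_def invertible_def by auto
qed (auto simp: GL_def matrix_mul_assoc invertible_mult invertible_mat_1)

lemma inv_GL: "A ** B = mat 1 \<Longrightarrow> inv\<^bsub>GL\<^esub> (A :: real^'n^'n::finite) = B"
  by (rule group.inv_equality[OF group_GL])
    (auto simp: GL_def matrix_left_right_inverse invertible_right_inverse invertible_left_inverse)

text \<open>A normalizing element satisfies \<open>\<phi> H = H \<phi>\<close>, so it maps the orbit
  of a point onto the orbit of the image point.\<close>

lemma congruent_orbits_if_normalizes:
  assumes "\<phi> ** \<psi> = mat 1"
    and "\<And>h. h \<in> H \<Longrightarrow> \<phi> ** h ** \<psi> \<in> H" "\<And>h. h \<in> H \<Longrightarrow> \<psi> ** h ** \<phi> \<in> H"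
  shows "congruent_orbits (GL_orbit H p) (GL_orbit H (\<phi> <#\<^bsub>GL\<^esub> p))"
proof -
  have inv: "\<psi> ** \<phi> = mat 1"
    using assms(1) by (rule iffD1[OF matrix_left_right_inverse])
  have 1: "\<phi> ** h = (\<phi> ** h ** \<psi>) ** \<phi>" for h
    by (metis inv matrix_mul_assoc matrix_mul_rid)
  have 2: "h ** \<phi> = \<phi> ** (\<psi> ** h ** \<phi>)" for h
    by (metis assms(1) matrix_mul_assoc matrix_mul_lid)
  have "(\<lambda>q. \<phi> <#\<^bsub>GL\<^esub> q) ` GL_orbit H p = GL_orbit H (\<phi> <#\<^bsub>GL\<^esub> p)"
    unfolding GL_orbit_eq image_image l_coset_GL_assoc
  proof (intro equalityI subsetI; elim imageE)
    fix x h assume "x = (\<phi> ** h) <#\<^bsub>GL\<^esub> p" "h \<in> H"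
    then show "x \<in> (\<lambda>h. (h ** \<phi>) <#\<^bsub>GL\<^esub> p) ` H"
      using 1[of h] assms(2) by (intro image_eqI[of _ _ "\<phi> ** h ** \<psi>"]) simp_all
  next
    fix x h assume "x = (h ** \<phi>) <#\<^bsub>GL\<^esub> p" "h \<in> H"
    then show "x \<in> (\<lambda>h. (\<phi> ** h) <#\<^bsub>GL\<^esub> p) ` H"
      using 2[of h] assms(3) by (intro image_eqI[of _ _ "\<psi> ** h ** \<phi>"]) simp_all
  qed
  moreover have "\<phi> \<in> carrier GL"
    using assms(1) by (auto simp: GL_def invertible_right_inverse)
  ultimately show ?thesis
    unfolding congruent_orbits_def by blast
qed

section \<open>The stabilizer of a coordinate subspace is transitive\<close>

definition coord_space :: "'n set \<Rightarrow> (real^'n) set" where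
  "coord_space Z = {x. \<forall>i. i \<notin> Z \<longrightarrow> x $ i = 0}"

lemma subspace_coord_space: "subspace (coord_space Z)"
  by (auto simp: subspace_def coord_space_def)

text \<open>An isometry between the two subspaces and one between their orthogonal complements are
  glued along the orthogonal splitting.\<close>

lemma orthogonal_matrix_onto:
  fixes W :: "(real^'n) set"
  assumes W: "subspace W" "dim W = dim (coord_space Z :: (real^'n) set)"
  obtains Q :: "real^'n^'n" where "orthogonal_matrix Q" "(*v) Q ` coord_space Z = W"
proof -
  let ?C = "coord_space Z :: (real^'n) set"
  define C' where "C' = {y \<in> UNIV. \<forall>x\<in>?C. orthogonal x y}"
  define W' where "W' = {y \<in> UNIV. \<forall>x\<in>W. orthogonal x y}"
  have "dim C' + dim ?C = dim (UNIV :: (real^'n) set)" "dim W' + dim W = dim (UNIV :: (real^'n) set)"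
    unfolding C'_def W'_def
    by (intro dim_subspace_orthogonal_to_vectors subspace_coord_space W subspace_UNIV subset_UNIV)+
  then have dim: "dim C' = dim W'"
    using W by simp
  have sub: "subspace C'" "subspace W'"
    unfolding C'_def W'_def by (auto simp: subspace_def orthogonal_clauses)
  obtain f\<^sub>1 where f\<^sub>1: "linear f\<^sub>1" "f\<^sub>1 ` ?C = W" "\<And>x. x \<in> ?C \<Longrightarrow> norm (f\<^sub>1 x) = norm x"
    using isometries_subspaces[OF subspace_coord_space W(1) W(2)[symmetric]] by metis
  obtain f\<^sub>2 where f\<^sub>2: "linear f\<^sub>2" "f\<^sub>2 ` C' = W'" "\<And>x. x \<in> C' \<Longrightarrow> norm (f\<^sub>2 x) = norm x"
    using isometries_subspaces[OF sub dim] by metis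
  define pr :: "real^'n \<Rightarrow> real^'n" where "pr x = (\<chi> i. if i \<in> Z then x $ i else 0)" for x
  have lin_pr: "linear pr"
    by (auto intro!: linearI simp: pr_def vec_eq_iff)
  have pr: "pr x \<in> ?C" "x - pr x \<in> C'" for x
    by (auto simp: pr_def coord_space_def C'_def orthogonal_def inner_vec_def intro!: sum.neutral)
  define f where "f x = f\<^sub>1 (pr x) + f\<^sub>2 (x - pr x)" for x
  have "f = (\<lambda>x. (f\<^sub>1 \<circ> pr) x + (f\<^sub>2 \<circ> (\<lambda>x. x - pr x)) x)"
    by (simp add: f_def fun_eq_iff)
  then have lin: "linear f"
    using linear_compose_add[OF linear_compose[OF lin_pr f\<^sub>1(1)]
        linear_compose[OF linear_compose_sub[OF linear_id[unfolded id_def] lin_pr] f\<^sub>2(1)]]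
    by simp
  have "norm (f x) = norm x" for x
  proof -
    have "orthogonal (f\<^sub>1 (pr x)) (f\<^sub>2 (x - pr x))"
      using f\<^sub>1(2) f\<^sub>2(2) pr[of x] unfolding W'_def by blast
    then have "norm (f x) ^ 2 = norm (pr x) ^ 2 + norm (x - pr x) ^ 2"
      using norm_add_Pythagorean[of "f\<^sub>1 (pr x)" "f\<^sub>2 (x - pr x)"] pr[of x] f\<^sub>1(3) f\<^sub>2(3) by (simp add: f_def)
    moreover have "orthogonal (pr x) (x - pr x)"
      using pr[of x] unfolding C'_def by blast
    then have "norm x ^ 2 = norm (pr x) ^ 2 + norm (x - pr x) ^ 2"
      using norm_add_Pythagorean[of "pr x" "x - pr x"] by simp
    ultimately show ?thesis
      by (metis norm_ge_zero power2_eq_imp_eq)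
  qed
  then have "orthogonal_matrix (matrix f)"
    using lin orthogonal_transformation orthogonal_transformation_matrix by blast
  moreover have "(*v) (matrix f) ` ?C = W"
  proof -
    have "matrix f *v x = f\<^sub>1 x" if "x \<in> ?C" for x
    proof -
      have "pr x = x"
        using that by (auto simp: pr_def coord_space_def vec_eq_iff)
      then show ?thesis
        using lin linear_0[OF f\<^sub>2(1)] by (simp add: f_def matrix_works linear_matrix_vector_mul_eq)
    qed
    then show ?thesis
      using f\<^sub>1(2) by simp
  qed
  ultimately show ?thesis
    using that by blast
qed

lemma image_matrix_mult: "(*v) (A ** B) ` S = (*v) A ` (*v) B ` (S :: (real^'n) set)"
  by (simp add: image_image matrix_vector_mul_assoc)

text \<open>A block form of the QR decomposition. An orthogonal \<open>q\<close> that carries the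
  coordinate subspace onto its preimage under \<open>m\<close> makes \<open>m ** q\<close> preserve
  the subspace.\<close>

lemma invertible_block_orthogonal:
  fixes m :: "real^'n^'n"
  assumes "invertible m"
  obtains p k where "m = p ** k" "orthogonal_matrix k" "invertible p"
    "(*v) p ` coord_space Z = coord_space Z"
proof -
  let ?C = "coord_space Z :: (real^'n) set"
  obtain n where n: "m ** n = mat 1" "n ** m = mat 1"
    using assms unfolding invertible_def by blast
  have inj: "inj ((*v) n)"
    using n matrix_left_invertible_injective by blast
  have "dim ((*v) n ` ?C) = dim ?C"
    by (rule dim_image_eq) (auto intro: inj_on_subset[OF inj] matrix_vector_mul_linear)
  then obtain q where q: "orthogonal_matrix q" "(*v) q ` ?C = (*v) n ` ?C"
    using orthogonal_matrix_onto[of "(*v) n ` ?C"] subspace_coord_space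
    by (metis linear_subspace_image matrix_vector_mul_linear)
  have "(*v) (m ** q) ` ?C = (*v) m ` (*v) q ` ?C"
    by (simp add: image_image matrix_vector_mul_assoc)
  also have "\<dots> = ?C"
    unfolding q(2) by (simp add: image_image matrix_vector_mul_assoc n)
  finally have "(*v) (m ** q) ` ?C = ?C" .
  moreover have "m = (m ** q) ** transpose q"
    using q(1) by (simp add: matrix_mul_assoc[symmetric] orthogonal_matrix_def)
  moreover have "invertible (m ** q)"
    using assms q(1) by (intro invertible_mult) (auto simp: orthogonal_matrix_def invertible_def)
  ultimately show ?thesis
    using that q(1) orthogonal_matrix_transpose by blast
qed

definition block_scalar :: "'n set \<Rightarrow> real \<Rightarrow> real \<Rightarrow> real^'n^'n::finite \<Rightarrow> bool" where
  "block_scalar Z a b M \<longleftrightarrow>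
     (\<forall>x. M *v x - a *\<^sub>R x \<in> coord_space Z) \<and> (\<forall>z\<in>coord_space Z. M *v z = b *\<^sub>R z)"

text \<open>The two scalars are independent, and the block from the complementary coordinates into
  \<open>Z\<close> is arbitrary.\<close>

definition block_scalars :: "'n set \<Rightarrow> (real^'n^'n::finite) set" where
  "block_scalars Z = {M. \<exists>a>0. \<exists>b>0. block_scalar Z a b M}"

lemma block_scalar_mult:
  assumes "block_scalar Z a b M" "block_scalar Z c d N"
  shows "block_scalar Z (a * c) (b * d) (M ** N)"
  unfolding block_scalar_def
proof (intro conjI allI ballI)
  fix x
  have "M *v (N *v x) - a *\<^sub>R (N *v x) + a *\<^sub>R (N *v x - c *\<^sub>R x) \<in> coord_space Z"
    using assms by (intro subspace_add subspace_scale subspace_coord_space) (auto simp: block_scalar_def)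
  then show "(M ** N) *v x - (a * c) *\<^sub>R x \<in> coord_space Z"
    by (simp add: matrix_vector_mul_assoc algebra_simps)
next
  fix z :: "real^'a" assume "z \<in> coord_space Z"
  then show "(M ** N) *v z = (b * d) *\<^sub>R z"
    using assms by (simp add: block_scalar_def matrix_vector_mul_assoc[symmetric]
        matrix_vector_mult_scaleR subspace_scale[OF subspace_coord_space])
qed

lemma block_scalar_invertible:
  assumes M: "block_scalar Z a b M" and "a \<noteq> 0" "b \<noteq> 0"
  shows "invertible M"
proof -
  have "x = 0" if "M *v x = 0" for x
  proof -
    have "- a *\<^sub>R x \<in> coord_space Z"
      using M that unfolding block_scalar_def by (metis diff_0 scaleR_minus_left)
    then have "x \<in> coord_space Z"
      using \<open>a \<noteq> 0\<close> by (simp add: coord_space_def)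
    then show ?thesis
      using M that \<open>b \<noteq> 0\<close> by (simp add: block_scalar_def)
  qed
  then show ?thesis
    by (simp add: invertible_left_inverse matrix_left_invertible_ker)
qed

lemma block_scalar_inverse:
  assumes M: "block_scalar Z a b M" and ab: "a \<noteq> 0" "b \<noteq> 0" and N: "M ** N = mat 1"
  shows "block_scalar Z (1 / a) (1 / b) N"
proof -
  have MN: "M *v (N *v x) = x" and NM: "N *v (M *v x) = x" for x
    using N N[THEN iffD1[OF matrix_left_right_inverse]] by (simp_all add: matrix_vector_mul_assoc)
  have Nz: "N *v z = (1 / b) *\<^sub>R z" if "z \<in> coord_space Z" for z
  proof -
    have "N *v (M *v z) = b *\<^sub>R (N *v z)"
      using M that by (simp add: block_scalar_def matrix_vector_mult_scaleR)
    then show ?thesis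
      using ab(2) unfolding NM by (metis inverse_eq_divide left_inverse scaleR_one scaleR_scaleR)
  qed
  moreover have "N *v x - (1 / a) *\<^sub>R x \<in> coord_space Z" for x
  proof -
    have "M *v (N *v x) - a *\<^sub>R (N *v x) \<in> coord_space Z"
      using M unfolding block_scalar_def by blast
    then have "(- (1 / a)) *\<^sub>R (x - a *\<^sub>R (N *v x)) \<in> coord_space Z"
      unfolding MN by (rule subspace_scale[OF subspace_coord_space])
    then show ?thesis
      using ab by (simp add: algebra_simps)
  qed
  ultimately show ?thesis
    by (simp add: block_scalar_def)
qed

text \<open>Being scalar on a subspace and on the quotient by it does not depend on a basis, so any
  matrix that preserves the subspace may be used for conjugation, and even the scalars stay the
  same.\<close>

lemma block_scalar_conj:
  assumes M: "block_scalar Z a b M" and inv: "p ** q = mat 1"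
    and p: "(*v) p ` coord_space Z = coord_space Z"
  shows "block_scalar Z a b (p ** M ** q)"
  unfolding block_scalar_def
proof (intro conjI allI ballI)
  have pq: "p *v (q *v x) = x" and qp: "q *v (p *v x) = x" for x
    using inv inv[THEN iffD1[OF matrix_left_right_inverse]] by (simp_all add: matrix_vector_mul_assoc)
  fix x
  have "M *v (q *v x) - a *\<^sub>R (q *v x) \<in> coord_space Z"
    using M by (simp add: block_scalar_def)
  then have "p *v (M *v (q *v x) - a *\<^sub>R (q *v x)) \<in> coord_space Z"
    using p by blast
  then show "(p ** M ** q) *v x - a *\<^sub>R x \<in> coord_space Z"
    by (simp add: matrix_vector_mul_assoc[symmetric] matrix_vector_mult_diff_distrib
        matrix_vector_mult_scaleR pq)
  fix z :: "real^'a" assume "z \<in> coord_space Z"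
  then obtain w where "w \<in> coord_space Z" "z = p *v w"
    using p by blast
  then show "(p ** M ** q) *v z = b *\<^sub>R z"
    using M by (simp add: matrix_vector_mul_assoc[symmetric] qp block_scalar_def
        matrix_vector_mult_scaleR)
qed

text \<open>Both points have representatives \<open>p\<close> and \<open>q\<close> that preserve the
  coordinate subspace. The matrix \<open>q ** p'\<close> carries one point to the other and
  normalizes the group.\<close>

lemma congruent_orbits_block_scalars:
  assumes "P \<in> GL_mod_O" "Q \<in> GL_mod_O"
  shows "congruent_orbits (GL_orbit (block_scalars Z) P) (GL_orbit (block_scalars Z) Q)"
proof -
  let ?C = "coord_space Z :: (real^'a) set"
  have rep: "\<exists>p p'. P = p <#\<^bsub>GL\<^esub> O_n \<and> p ** p' = mat 1 \<and> p' ** p = mat 1 \<and>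
      (*v) p ` ?C = ?C \<and> (*v) p' ` ?C = ?C"
    if P: "P \<in> GL_mod_O" for P :: "(real^'a^'a) set"
  proof -
    obtain m where m: "P = m <#\<^bsub>GL\<^esub> O_n" "invertible m"
      using P by (auto simp: GL_mod_O_eq)
    obtain p k where pk: "m = p ** k" "orthogonal_matrix k" "invertible p" "(*v) p ` ?C = ?C"
      using invertible_block_orthogonal[OF m(2)] by metis
    obtain p' where p': "p ** p' = mat 1" "p' ** p = mat 1"
      using pk(3) unfolding invertible_def by blast
    have "(*v) p' ` ?C = (*v) p' ` (*v) p ` ?C"
      by (simp add: pk(4))
    also have "\<dots> = ?C"
      by (simp add: image_image matrix_vector_mul_assoc p')
    finally show ?thesis
      using m(1) pk p' l_coset_O_n by blast
  qed
  obtain p p' where p: "P = p <#\<^bsub>GL\<^esub> O_n" "p ** p' = mat 1" "p' ** p = mat 1"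
      "(*v) p ` ?C = ?C" "(*v) p' ` ?C = ?C"
    using rep[OF assms(1)] by blast
  obtain q q' where q: "Q = q <#\<^bsub>GL\<^esub> O_n" "q ** q' = mat 1" "q' ** q = mat 1"
      "(*v) q ` ?C = ?C" "(*v) q' ` ?C = ?C"
    using rep[OF assms(2)] by blast
  have "(q ** p') ** (p ** q') = q ** (p' ** p) ** q'"
    by (simp add: matrix_mul_assoc)
  then have inv: "(q ** p') ** (p ** q') = mat 1"
    by (simp add: p(3) q(2))
  then have inv': "(p ** q') ** (q ** p') = mat 1"
    by (rule iffD1[OF matrix_left_right_inverse])
  have "(*v) (q ** p') ` ?C = ?C" "(*v) (p ** q') ` ?C = ?C"
    unfolding image_matrix_mult p(4,5) q(4,5) by (rule refl)+
  then have "(q ** p') ** h ** (p ** q') \<in> block_scalars Z" "(p ** q') ** h ** (q ** p') \<in> block_scalars Z"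
    if "h \<in> block_scalars Z" for h
  proof -
    obtain a b where ab: "a > 0" "b > 0" "block_scalar Z a b h"
      using \<open>h \<in> block_scalars Z\<close> by (auto simp: block_scalars_def)
    with block_scalar_conj[OF ab(3) inv] block_scalar_conj[OF ab(3) inv'] \<open>(*v) (q ** p') ` ?C = ?C\<close>
      \<open>(*v) (p ** q') ` ?C = ?C\<close>
    show "(q ** p') ** h ** (p ** q') \<in> block_scalars Z" "(p ** q') ** h ** (q ** p') \<in> block_scalars Z"
      unfolding block_scalars_def by blast+
  qed
  then have "congruent_orbits (GL_orbit (block_scalars Z) P)
      (GL_orbit (block_scalars Z) ((q ** p') <#\<^bsub>GL\<^esub> P))"
    by (intro congruent_orbits_if_normalizes[OF inv])
  moreover have "(q ** p') ** p = q"
    by (simp add: matrix_mul_assoc[symmetric] p(3))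
  then have "(q ** p') <#\<^bsub>GL\<^esub> P = Q"
    by (simp add: p(1) q(1) l_coset_GL_assoc)
  ultimately show ?thesis by simp
qed

text \<open>The rows of \<open>h k\<close> with index outside \<open>Z\<close> all have the same length when \<open>h\<close> is a block scalar
  and \<open>k\<close> is orthogonal.\<close>

lemma not_transitive_block_scalars:
  assumes ij: "i \<notin> Z" "j \<notin> Z" "i \<noteq> j"
  shows "\<not> transitive_on_GL_mod_O (block_scalars Z)"
proof
  assume trans: "transitive_on_GL_mod_O (block_scalars Z)"
  define D :: "real^'a^'a" where "D = (\<chi> r s. if r = s then (if r = i then 2 else 1) else 0)"
  have "det D = (\<Prod>r\<in>UNIV. D $ r $ r)"
    by (rule det_diagonal) (simp add: D_def)
  then have "invertible D"
    by (simp add: invertible_det_nz D_def)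
  then have "D <#\<^bsub>GL\<^esub> O_n \<in> GL_mod_O" "mat 1 <#\<^bsub>GL\<^esub> O_n \<in> (GL_mod_O :: (real^'a^'a) set set)"
    using invertible_mat_1 by (auto simp: GL_mod_O_eq)
  then have "D <#\<^bsub>GL\<^esub> O_n \<in> GL_orbit (block_scalars Z) (mat 1 <#\<^bsub>GL\<^esub> O_n)"
    using trans unfolding transitive_on_GL_mod_O_def by blast
  then obtain h where h: "h \<in> block_scalars Z" "D <#\<^bsub>GL\<^esub> O_n = h <#\<^bsub>GL\<^esub> O_n"
    by (auto simp: GL_orbit_eq l_coset_GL_assoc)
  have "D \<in> D <#\<^bsub>GL\<^esub> O_n"
    by (auto simp: l_coset_GL O_n_def orthogonal_matrix_id intro!: image_eqI[of _ _ "mat 1"])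
  then obtain k where k: "D = h ** k" "orthogonal_matrix k"
    using h(2) by (auto simp: l_coset_GL O_n_def)
  obtain a b where a: "block_scalar Z a b h"
    using h(1) by (auto simp: block_scalars_def)
  have row: "(D ** transpose D) $ r $ r = a\<^sup>2" if "r \<notin> Z" for r
  proof -
    have h_row: "h $ r $ s = (if r = s then a else 0)" for s
    proof -
      have "(h *v axis s 1 - a *\<^sub>R axis s 1) $ r = 0"
        using a that unfolding block_scalar_def coord_space_def by blast
      moreover have "(h *v axis s 1) $ r = h $ r $ s"
        by (simp add: matrix_vector_mul_component inner_axis)
      moreover have "axis s 1 $ r = (if r = s then 1 else 0 :: real)"
        by (simp add: axis_def)
      ultimately show ?thesis
        by (simp split: if_splits)
    qed
    \<comment> \<open>The Gram matrix of the rows depends only on the coset, as the orthogonal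
      factor cancels.\<close>
    have "D ** transpose D = h ** transpose h"
    proof -
      have "D ** transpose D = h ** (k ** transpose k) ** transpose h"
        by (simp add: k(1) matrix_transpose_mul matrix_mul_assoc)
      then show ?thesis
        using k(2) by (simp add: orthogonal_matrix_def)
    qed
    then have "(D ** transpose D) $ r $ r = (\<Sum>s\<in>UNIV. h $ r $ s * h $ r $ s)"
      by (simp add: matrix_matrix_mult_def[of h] transpose_def[of h])
    also have "\<dots> = (\<Sum>s\<in>UNIV. if r = s then a\<^sup>2 else 0)"
      by (intro sum.cong refl) (simp add: h_row power2_eq_square)
    finally show ?thesis by simp
  qed
  have D_row: "(D ** transpose D) $ r $ r = (if r = i then 4 else 1)" for r
  proof -
    have "(D ** transpose D) $ r $ r = (\<Sum>s\<in>UNIV. D $ r $ s * D $ r $ s)"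
      by (simp add: matrix_matrix_mult_def transpose_def)
    also have "\<dots> = (\<Sum>s\<in>UNIV. if r = s then (if r = i then 4 else 1) else 0)"
      by (intro sum.cong refl) (simp add: D_def)
    finally show ?thesis by simp
  qed
  show False
    using D_row[of i] D_row[of j]  row[OF ij(1)] row[OF ij(2)] ij(3) by simp
qed

section \<open>Block scalars as automorphisms\<close>

context two_step
begin

lemma bracket_coord_space: "br x y \<in> coord_space Z"
  by (simp add: coord_space_def bracket_nth)

lemma bracket_central: "z \<in> coord_space Z \<Longrightarrow> br x z = 0" "z \<in> coord_space Z \<Longrightarrow> br z x = 0"
  using central[of z x] bracket_commute[of z x] by (auto simp: coord_space_def)

lemma block_scalar_Aut:
  assumes "a \<noteq> 0" and M: "block_scalar Z a (a\<^sup>2) M"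
  shows "M \<in> Aut br"
proof -
  have "M *v br x y = br (M *v x) (M *v y)" for x y
  proof -
    have "M *v x - a *\<^sub>R x \<in> coord_space Z" "M *v y - a *\<^sub>R y \<in> coord_space Z"
      using M unfolding block_scalar_def by blast+
    then have "br (M *v x - a *\<^sub>R x) (M *v y) = 0" "br (a *\<^sub>R x) (M *v y - a *\<^sub>R y) = 0"
      by (blast intro: bracket_central)+
    then have "br (M *v x) (M *v y) = a\<^sup>2 *\<^sub>R br x y"
      by (simp add: power2_eq_square)
    then show ?thesis
      using M bracket_coord_space by (simp add: block_scalar_def)
  qed
  moreover have "invertible M"
    using block_scalar_invertible[OF M] assms(1) by simp
  ultimately show ?thesis
    by (simp add: Aut_def)
qed

text \<open>These matrices are a continuous image of a half-line times a vector space, hence form a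
  connected set of automorphisms, and it contains the identity.\<close>

lemma block_scalar_Aut0:
  assumes "a > 0" and M: "block_scalar Z a (a\<^sup>2) M"
  shows "M \<in> Aut0 br"
proof -
  define p :: "real^'n \<Rightarrow> real^'n" where "p x = (\<chi> i. if i \<in> Z then x $ i else 0)" for x
  have lin: "linear p"
    by (auto intro!: linearI simp: p_def vec_eq_iff)
  have p: "p x \<in> coord_space Z" "z \<in> coord_space Z \<Longrightarrow> p z = z" for x z
    by (auto simp: p_def coord_space_def vec_eq_iff)
  define P where "P = matrix p"
  have P: "P *v x = p x" for x
    using lin by (simp add: P_def matrix_works linear_matrix_vector_mul_eq)
  \<comment> \<open>\<open>F (t, L)\<close> has the scalars \<open>t\<close> and
    \<open>t\<^sup>2\<close> and takes its off-diagonal block from \<open>L\<close>. Thus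
    \<open>F (1, 0)\<close> is the identity and \<open>F (a, M)\<close> recovers
    \<open>M\<close>.\<close>
  define F where "F = (\<lambda>(t::real, L). t *\<^sub>R (mat 1 - P) + t\<^sup>2 *\<^sub>R P + P ** L ** (mat 1 - P))"
  have F: "F (t, L) *v x = t *\<^sub>R (x - p x) + t\<^sup>2 *\<^sub>R p x + p (L *v (x - p x))" for t L x
    by (simp add: F_def matrix_vector_mult_add_rdistrib matrix_vector_mult_diff_rdistrib
        scaleR_matrix_vector_assoc[symmetric] matrix_vector_mul_assoc[symmetric] P)
  have scal: "block_scalar Z t (t\<^sup>2) (F (t, L))" for t L
    unfolding block_scalar_def
  proof (intro conjI allI ballI)
    fix x
    have "F (t, L) *v x - t *\<^sub>R x = (t\<^sup>2 - t) *\<^sub>R p x + p (L *v (x - p x))"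
      by (simp add: F algebra_simps)
    also have "\<dots> \<in> coord_space Z"
      by (intro subspace_add subspace_scale subspace_coord_space p)
    finally show "F (t, L) *v x - t *\<^sub>R x \<in> coord_space Z" .
    fix z :: "real^'n" assume "z \<in> coord_space Z"
    then show "F (t, L) *v z = t\<^sup>2 *\<^sub>R z"
      using linear_0[OF lin] by (simp add: F p)
  qed
  let ?S = "F ` ({0<..} \<times> UNIV)"
  have "continuous_on ({0<..} \<times> UNIV) F"
  proof -
    have "continuous_on ({0<..} \<times> UNIV) (\<lambda>x :: real \<times> (real^'n^'n). P ** snd x ** (mat 1 - P))"
    proof -
      have "linear (\<lambda>L :: real^'n^'n. P ** L ** (mat 1 - P))"
        by (rule linearI)
          (simp_all add: matrix_eq matrix_vector_mul_assoc[symmetric] matrix_vector_mult_add_rdistrib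
            matrix_vector_right_distrib matrix_vector_mult_scaleR scaleR_matrix_vector_assoc[symmetric])
      then show ?thesis
        using continuous_on_compose2[OF linear_continuous_on[OF linear_conv_bounded_linear[THEN iffD1]]]
          continuous_on_snd[OF continuous_on_id] by blast
    qed
    then show ?thesis
      unfolding F_def case_prod_unfold by (intro continuous_intros)
  qed
  moreover have "connected ({0::real<..} \<times> (UNIV :: (real^'n^'n) set))"
    by (intro connected_Times connected_Ioi connected_UNIV)
  ultimately have "connected ?S"
    using connected_continuous_image by blast
  moreover have "?S \<subseteq> Aut br"
  proof -
    have "F (t, L) \<in> Aut br" if "0 < t" for t L
      using block_scalar_Aut[OF _ scal] that by simp
    then show ?thesis by auto
  qed
  moreover have "mat 1 \<in> ?S"
  proof -
    have "F (1, 0) = mat 1"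
      by (simp add: matrix_eq F linear_0[OF lin])
    then show ?thesis by (intro image_eqI[of _ _ "(1, 0)"]) auto
  qed
  moreover have "M \<in> ?S"
  proof -
    have "F (a, M) *v x = M *v x" for x
    proof -
      have "M *v p x = a\<^sup>2 *\<^sub>R p x"
        using M p(1)[of x] by (simp add: block_scalar_def)
      moreover have "p (M *v (x - p x) - a *\<^sub>R (x - p x)) = M *v (x - p x) - a *\<^sub>R (x - p x)"
        using M p(2) unfolding block_scalar_def by blast
      moreover have "p (x - p x) = 0"
        using p(2)[OF p(1)] linear_diff[OF lin] by simp
      ultimately show ?thesis
        using linear_diff[OF lin] linear_cmul[OF lin] by (simp add: F matrix_vector_mult_diff_distrib)
    qed
    then have "F (a, M) = M"
      by (simp add: matrix_eq)
    then show ?thesis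
      using assms(1) by (intro image_eqI[of _ _ "(a, M)"]) auto
  qed
  ultimately show ?thesis
    using connected_component_maximal[of "mat 1" ?S "Aut br"] by (auto simp: Aut0_def)
qed

lemma RAut0_eq:
  assumes aut: "\<And>M. M \<in> Aut0 br \<Longrightarrow> \<exists>a>0. block_scalar Z a (a\<^sup>2) M"
  shows "RAut0 br = block_scalars Z"
proof (intro equalityI subsetI)
  let ?S = "{t *\<^sub>R mat 1 | t. t > 0} \<union> Aut0 br"
  have S: "?S \<subseteq> block_scalars Z"
  proof -
    have "t *\<^sub>R mat 1 \<in> block_scalars Z" if "t > 0" for t
      using that subspace_0[OF subspace_coord_space, of Z]
      by (auto simp: block_scalars_def block_scalar_def scaleR_matrix_vector_assoc[symmetric]
          intro!: exI[of _ t])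
    moreover have "M \<in> block_scalars Z" if "M \<in> Aut0 br" for M
      using aut[OF that] by (auto simp: block_scalars_def intro: zero_less_power)
    ultimately show ?thesis by auto
  qed
  fix M assume "M \<in> RAut0 br"
  then show "M \<in> block_scalars Z"
    unfolding RAut0_def
  proof (induction rule: generate.induct)
    case one
    have "(mat 1 :: real^'n^'n) \<in> block_scalars Z"
      using S by (auto intro!: exI[of _ 1])
    then show ?case by (simp add: GL_def)
  next
    case (incl h)
    then show ?case using S by blast
  next
    case (inv h)
    then obtain a b where ab: "a > 0" "b > 0" "block_scalar Z a b h"
      using S by (auto simp: block_scalars_def)
    then obtain h' where h': "h ** h' = mat 1"
      using block_scalar_invertible[of Z a b h] by (auto simp: invertible_def)
    then show ?case
      using block_scalar_inverse[OF ab(3) _ _ h'] ab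
      unfolding inv_GL[OF h'] block_scalars_def
      by (metis (mono_tags, lifting) mem_Collect_eq zero_less_divide_1_iff less_irrefl)
  next
    case (eng h k)
    then obtain a b c d where "a > 0" "b > 0" "block_scalar Z a b h" "c > 0" "d > 0" "block_scalar Z c d k"
      by (auto simp: block_scalars_def)
    then have "block_scalar Z (a * c) (b * d) (h ** k)" "a * c > 0" "b * d > 0"
      by (auto intro: block_scalar_mult)
    then show ?case
      by (auto simp: GL_def block_scalars_def)
  qed
next
  fix M assume "M \<in> block_scalars Z"
  then obtain a b where ab: "a > 0" "b > 0" "block_scalar Z a b M"
    by (auto simp: block_scalars_def)
  \<comment> \<open>Dividing by this \<open>t\<close> turns the scalars \<open>a\<close>,
    \<open>b\<close> into \<open>b / a\<close> and its square, as required of an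
    automorphism.\<close>
  define t where "t = a\<^sup>2 / b"
  have t: "t > 0" "(1 / t) * a = b / a" "(1 / t) * b = (b / a)\<^sup>2"
    using ab by (auto simp: t_def power2_eq_square field_simps)
  have "block_scalar Z (1 / t) (1 / t) ((1 / t) *\<^sub>R mat 1)"
    using subspace_0[OF subspace_coord_space, of Z]
    by (simp add: block_scalar_def scaleR_matrix_vector_assoc[symmetric])
  from block_scalar_mult[OF this ab(3)] have "block_scalar Z (b / a) ((b / a)\<^sup>2) ((1 / t) *\<^sub>R mat 1 ** M)"
    by (simp only: t)
  then have "(1 / t) *\<^sub>R mat 1 ** M \<in> Aut0 br"
    using ab by (intro block_scalar_Aut0) auto
  moreover have "M = t *\<^sub>R mat 1 ** ((1 / t) *\<^sub>R mat 1 ** M)"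
    using t(1) by (simp add: matrix_eq matrix_vector_mul_assoc[symmetric] scaleR_matrix_vector_assoc[symmetric])
  ultimately show "M \<in> RAut0 br"
    unfolding RAut0_def
    using generate.eng[of "t *\<^sub>R mat 1" GL "{t *\<^sub>R mat 1 | t. t > 0} \<union> Aut0 br"
        "(1 / t) *\<^sub>R mat 1 ** M"] t(1) generate.incl[of _ "{t *\<^sub>R mat 1 | t. t > 0} \<union> Aut0 br" GL]
    by (auto simp: GL_def)
qed

end

section \<open>The nine-dimensional example\<close>

lemma exhaust_9:
  fixes x :: 9
  shows "x = 1 \<or> x = 2 \<or> x = 3 \<or> x = 4 \<or> x = 5 \<or> x = 6 \<or> x = 7 \<or> x = 8 \<or> x = 9"
proof (induct x)
  case (of_int z)
  then have "z = 0 \<or> z = 1 \<or> z = 2 \<or> z = 3 \<or> z = 4 \<or> z = 5 \<or> z = 6 \<or> z = 7 \<or> z = 8" by fastforce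
  then show ?case by auto
qed

lemma forall_9: "(\<forall>i::9. P i) \<longleftrightarrow> P 1 \<and> P 2 \<and> P 3 \<and> P 4 \<and> P 5 \<and> P 6 \<and> P 7 \<and> P 8 \<and> P 9"
  by (metis exhaust_9)

lemma UNIV_9: "UNIV = {1, 2, 3, 4, 5, 6, 7, 8, 9 :: 9}"
  using exhaust_9 by auto

lemma sum_9: "sum f (UNIV :: 9 set) = f 1 + f 2 + f 3 + f 4 + f 5 + f 6 + f 7 + f 8 + f 9"
  unfolding UNIV_9 by (simp add: ac_simps)

definition vec9 :: "real \<Rightarrow> real \<Rightarrow> real \<Rightarrow> real \<Rightarrow> real \<Rightarrow> real \<Rightarrow> real \<Rightarrow> real \<Rightarrow> real \<Rightarrow> real^9" where
  "vec9 a1 a2 a3 a4 a5 a6 a7 a8 a9 = (\<chi> i. if i = 1 then a1 else if i = 2 then a2 else if i = 3 then a3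
     else if i = 4 then a4 else if i = 5 then a5 else if i = 6 then a6 else if i = 7 then a7
     else if i = 8 then a8 else a9)"

lemma vec9_nth [simp]:
  "vec9 a1 a2 a3 a4 a5 a6 a7 a8 a9 $ 1 = a1" "vec9 a1 a2 a3 a4 a5 a6 a7 a8 a9 $ 2 = a2"
  "vec9 a1 a2 a3 a4 a5 a6 a7 a8 a9 $ 3 = a3" "vec9 a1 a2 a3 a4 a5 a6 a7 a8 a9 $ 4 = a4"
  "vec9 a1 a2 a3 a4 a5 a6 a7 a8 a9 $ 5 = a5" "vec9 a1 a2 a3 a4 a5 a6 a7 a8 a9 $ 6 = a6"
  "vec9 a1 a2 a3 a4 a5 a6 a7 a8 a9 $ 7 = a7" "vec9 a1 a2 a3 a4 a5 a6 a7 a8 a9 $ 8 = a8"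
  "vec9 a1 a2 a3 a4 a5 a6 a7 a8 a9 $ 9 = a9"
  by (simp_all add: vec9_def)

lemma vec9_eq_iff: "x = y \<longleftrightarrow> x $ 1 = y $ 1 \<and> x $ 2 = y $ 2 \<and> x $ 3 = y $ 3 \<and> x $ 4 = y $ 4 \<and>
    x $ 5 = y $ 5 \<and> x $ 6 = y $ 6 \<and> x $ 7 = y $ 7 \<and> x $ 8 = y $ 8 \<and> x $ 9 = y $ 9"
  for x y :: "'a^9"
  by (simp add: vec_eq_iff forall_9)

text \<open>An orthonormal basis of the summand of the exterior square that is adapted to the subgroup
  \<open>A\<^sub>4\<close> of \<open>A\<^sub>5\<close>: \<open>\<real>\<^sup>5\<close> splits as \<open>3 + 2\<close>, and the coefficient vectors of \<open>y$4\<close> and \<open>y$5\<close> in the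
  components 6, 7 and 8 are \<open>sqrt 2\<close> times unit vectors at mutual angles of 120 degrees.\<close>

definition br9 :: "real^9 \<Rightarrow> real^9 \<Rightarrow> real^9" where
  "br9 x y = vec9 0 0 0 0 0
     (sqrt 3 * (x$2 * y$3 - x$3 * y$2) + sqrt 2 * (x$1 * y$4 - x$4 * y$1))
     (sqrt 3 * (x$3 * y$1 - x$1 * y$3) - sqrt 2 / 2 * (x$2 * y$4 - x$4 * y$2)
        + sqrt 2 * sqrt 3 / 2 * (x$2 * y$5 - x$5 * y$2))
     (sqrt 3 * (x$1 * y$2 - x$2 * y$1) - sqrt 2 / 2 * (x$3 * y$4 - x$4 * y$3)
        - sqrt 2 * sqrt 3 / 2 * (x$3 * y$5 - x$5 * y$3))
     (sqrt 5 * (x$4 * y$5 - x$5 * y$4))"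

lemma br9_nth [simp]:
  "br9 x y $ 1 = 0" "br9 x y $ 2 = 0" "br9 x y $ 3 = 0" "br9 x y $ 4 = 0" "br9 x y $ 5 = 0"
  "br9 x y $ 6 = sqrt 3 * (x$2 * y$3 - x$3 * y$2) + sqrt 2 * (x$1 * y$4 - x$4 * y$1)"
  "br9 x y $ 7 = sqrt 3 * (x$3 * y$1 - x$1 * y$3) - sqrt 2 / 2 * (x$2 * y$4 - x$4 * y$2)
        + sqrt 2 * sqrt 3 / 2 * (x$2 * y$5 - x$5 * y$2)"
  "br9 x y $ 8 = sqrt 3 * (x$1 * y$2 - x$2 * y$1) - sqrt 2 / 2 * (x$3 * y$4 - x$4 * y$3)
        - sqrt 2 * sqrt 3 / 2 * (x$3 * y$5 - x$5 * y$3)"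
  "br9 x y $ 9 = sqrt 5 * (x$4 * y$5 - x$5 * y$4)"
  by (simp_all add: br9_def)

definition Z9 :: "9 set" where "Z9 = {6, 7, 8, 9}"

lemma not_Z9: "i \<notin> Z9 \<longleftrightarrow> i \<in> {1, 2, 3, 4, 5}"
  using exhaust_9[of i] by (auto simp: Z9_def)

lemma coord_space_Z9: "z \<in> coord_space Z9 \<longleftrightarrow> z$1 = 0 \<and> z$2 = 0 \<and> z$3 = 0 \<and> z$4 = 0 \<and> z$5 = 0"
  by (auto simp: coord_space_def not_Z9)

interpretation br9: two_step br9 Z9
proof (intro two_step.intro two_step_axioms.intro)
  have "bilinear br9"
    unfolding bilinear_def by (auto intro!: linearI simp: vec9_eq_iff algebra_simps)
  then show "bounded_bilinear br9"
    by (simp add: bilinear_conv_bounded_bilinear)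
next
  fix x z :: "real^9" assume "\<And>i. i \<notin> Z9 \<Longrightarrow> z $ i = 0"
  then have "z$1 = 0 \<and> z$2 = 0 \<and> z$3 = 0 \<and> z$4 = 0 \<and> z$5 = 0"
    by (simp add: not_Z9)
  then show "br9 x z = 0"
    by (simp add: vec9_eq_iff)
qed (auto simp: vec9_eq_iff not_Z9)

lemma axis9_nth: "axis i (1::real) $ (j::9) = (if i = j then 1 else 0)"
  by (simp add: axis_def)

lemma real_sqrt_mult_self9: "sqrt 2 * (sqrt 2 * x) = 2 * x" "sqrt 3 * (sqrt 3 * x) = 3 * x"
  "sqrt 5 * (sqrt 5 * x) = 5 * (x::real)"
  by (simp_all flip: mult.assoc)

text \<open>The constants 8 here and 10 in the next lemma fit together: 5 * 8 = 4 * 10 is the total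
  squared length of the brackets of basis vectors.\<close>

lemma sum_inner_br9:
  "(\<Sum>k\<in>UNIV. br9 u (axis k 1) \<bullet> br9 v (axis k 1)) = 8 * (\<Sum>i\<in>-Z9. u $ i * v $ i)"
proof -
  have "- Z9 = {1, 2, 3, 4, 5}"
    using not_Z9 by auto
  then show ?thesis
    by (simp add: inner_vec_def sum_9 axis9_nth) (simp add: algebra_simps real_sqrt_mult_self9)
qed

lemma sum_sum_inner_br9:
  "(\<Sum>k\<in>UNIV. \<Sum>l\<in>UNIV. (u \<bullet> br9 (axis k 1) (axis l 1)) * (v \<bullet> br9 (axis k 1) (axis l 1))) =
     10 * (\<Sum>i\<in>Z9. u $ i * v $ i)"
  by (simp add: inner_vec_def sum_9 axis9_nth Z9_def) (simp add: algebra_simps real_sqrt_mult_self9)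

lemma ricci_soliton_br9: "ricci_soliton id_atlas (\<lambda>c. br9.metric)"
  by (rule br9.ricci_soliton_lie_grp[OF sum_inner_br9 sum_sum_inner_br9])

text \<open>The Pluecker relation says that the alternating form \<open>c \<bullet> br9 x y\<close> is decomposable.\<close>

definition pluecker :: "real^9 \<Rightarrow> bool" where
  "pluecker c \<longleftrightarrow> (\<forall>x y z w. (c \<bullet> br9 x y) * (c \<bullet> br9 z w) - (c \<bullet> br9 x z) * (c \<bullet> br9 y w)
     + (c \<bullet> br9 x w) * (c \<bullet> br9 y z) = 0)"

lemma inner_br9: "c \<bullet> br9 x y = c$6 * br9 x y $ 6 + c$7 * br9 x y $ 7 + c$8 * br9 x y $ 8 + c$9 * br9 x y $ 9"
  by (simp add: inner_vec_def sum_9)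

lemma pluecker_if_decomposable:
  assumes "\<And>x y. c \<bullet> br9 x y = f x * g y - f y * g x"
  shows "pluecker c"
  unfolding pluecker_def assms by (simp add: algebra_simps)

text \<open>Components 1 to 5 are left free because the form \<open>c \<bullet> br9 x y\<close> does
  not see them. In components 6 to 9 this is a line, the one singled out by the subgroup
  A_4.\<close>

definition dline0 :: "(real^9) set" where
  "dline0 = {c. c$6 = 0 \<and> c$7 = 0 \<and> c$8 = 0}"

text \<open>For signs \<open>a\<close> and \<open>b\<close>, components 6 to 9 are a multiple of
  (sqrt 5, a sqrt 5, b sqrt 5, a b). Up to signs, these four vectors and (0, 0, 0, 4) are the
  vertices of a regular simplex.\<close>

definition dline :: "real \<Rightarrow> real \<Rightarrow> (real^9) set" where
  "dline a b = {c. c$7 = a * c$6 \<and> c$8 = b * c$6 \<and> sqrt 5 * c$9 = a * b * c$6}"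

text \<open>Three coefficients of the wedge square of the form suffice. They make the squares of
  components 6, 7 and 8 equal, which leaves two signs, and these determine component 9 unless the
  other three vanish.\<close>

lemma pluecker_cases:
  assumes "pluecker c"
  shows "c \<in> dline0 \<or> c \<in> dline 1 1 \<or> c \<in> dline 1 (-1) \<or> c \<in> dline (-1) 1 \<or> c \<in> dline (-1) (-1)"
proof -
  let ?e = "\<lambda>i. axis i 1 :: real^9"
  let ?p = "c$6" and ?q = "c$7" and ?r = "c$8" and ?s = "c$9"
  have P: "(c \<bullet> br9 x y) * (c \<bullet> br9 z w) - (c \<bullet> br9 x z) * (c \<bullet> br9 y w)
     + (c \<bullet> br9 x w) * (c \<bullet> br9 y z) = 0" for x y z w
    using assms by (simp add: pluecker_def)
  note s = inner_br9 axis9_nth algebra_simps real_sqrt_mult_self9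
  have 1: "sqrt 3 * sqrt 2 * (2 * ?p\<^sup>2 - ?q\<^sup>2 - ?r\<^sup>2) = 0"
    using P[of "?e 1" "?e 2" "?e 3" "?e 4"] by (simp add: s power2_eq_square)
  have 2: "sqrt 2 * (?q\<^sup>2 - ?r\<^sup>2) = 0"
    using P[of "?e 1" "?e 2" "?e 3" "?e 5"] by (simp add: s power2_eq_square)
  have 3: "sqrt 3 * (sqrt 5 * (?p * ?s) - ?q * ?r) = 0"
    using P[of "?e 2" "?e 3" "?e 4" "?e 5"] by (simp add: s)
  have eqs: "?q\<^sup>2 = ?p\<^sup>2" "?r\<^sup>2 = ?p\<^sup>2" "sqrt 5 * (?p * ?s) = ?q * ?r"
    using 1 2 3 by simp_all
  show ?thesis
  proof (cases "?p = 0")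
    case True
    then show ?thesis using eqs by (simp add: dline0_def)
  next
    case False
    have sign: "\<exists>a. x = a * ?p \<and> (a = 1 \<or> a = -1)" if "x\<^sup>2 = ?p\<^sup>2" for x
      using that unfolding power2_eq_iff by (metis mult_1 mult_minus1)
    obtain a b where ab: "?q = a * ?p" "?r = b * ?p" "a = 1 \<or> a = -1" "b = 1 \<or> b = -1"
      using sign[OF eqs(1)] sign[OF eqs(2)] by blast
    have "?p * (sqrt 5 * ?s) = ?p * (a * b * ?p)"
      using eqs(3)[unfolded ab(1,2)] by (simp only: ac_simps)
    then have "sqrt 5 * ?s = a * b * ?p"
      using False by (simp only: mult_cancel_left) simp
    then have "c \<in> dline a b"
      using ab(1,2) unfolding dline_def by blast
    then show ?thesis
      using ab(3,4) by blast
  qed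
qed

lemma pluecker_dline0: "c \<in> dline0 \<Longrightarrow> pluecker c"
  by (rule pluecker_if_decomposable[of c "\<lambda>x. c$9 * sqrt 5 * x$4" "\<lambda>x. x$5"])
    (simp add: dline0_def inner_br9 algebra_simps)

lemma pluecker_dline:
  assumes ab: "a = 1 \<or> a = -1" "b = 1 \<or> b = -1"
  shows "pluecker (vec9 0 0 0 0 0 (sqrt 5) (sqrt 5 * a) (sqrt 5 * b) (a * b))"
  \<comment> \<open>A form of rank two is, up to a factor, the wedge product of two of its
    contractions. The factors below are multiples of the contractions with the first and the second
    basis vector.\<close>
  by (rule pluecker_if_decomposable[of _
        "\<lambda>x. 3 * x$2 - 3 * a * b * x$3 + b * (sqrt 2 * sqrt 3) * x$4"
        "\<lambda>y. sqrt 5 / 6 * (- 2 * b * sqrt 3 * y$1 + 2 * sqrt 3 * y$3 - a * sqrt 2 * y$4 + a * (sqrt 2 * sqrt 3) * y$5)"])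
    (insert ab, elim disjE; simp add: inner_br9 field_simps real_sqrt_mult_self9)

lemma closed_dline: "closed dline0" "closed (dline a b)"
  unfolding dline0_def dline_def
  by (intro closed_Collect_conj closed_Collect_eq continuous_intros)+

section \<open>Automorphisms acting on the forms\<close>

lemma Aut_br9_transpose:
  assumes "M \<in> Aut br9"
  shows "c \<bullet> br9 (M *v x) (M *v y) = (transpose M *v c) \<bullet> br9 x y"
proof -
  have "c \<bullet> br9 (M *v x) (M *v y) = c \<bullet> (M *v br9 x y)"
    using assms by (simp add: Aut_def)
  then show ?thesis
    by (simp add: dot_lmul_matrix)
qed

lemma pluecker_transpose: "M \<in> Aut br9 \<Longrightarrow> pluecker c \<Longrightarrow> pluecker (transpose M *v c)"
  unfolding pluecker_def Aut_br9_transpose[symmetric] by blast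

lemma br9_surj: "br9 (axis 2 1) (axis 3 1) = sqrt 3 *\<^sub>R axis 6 1"
  "br9 (axis 3 1) (axis 1 1) = sqrt 3 *\<^sub>R axis 7 1"
  "br9 (axis 1 1) (axis 2 1) = sqrt 3 *\<^sub>R axis 8 1"
  "br9 (axis 4 1) (axis 5 1) = sqrt 5 *\<^sub>R axis 9 1"
  by (simp_all add: vec9_eq_iff axis9_nth)

text \<open>Pulling back by an invertible matrix kills no nonzero form, and the form determines
  components 6 to 9 of \<open>c\<close> because brackets span the center.\<close>

lemma transpose_nonzero:
  assumes M: "M \<in> Aut br9" and 0: "(transpose M *v c) $ 6 = 0" "(transpose M *v c) $ 7 = 0"
    "(transpose M *v c) $ 8 = 0" "(transpose M *v c) $ 9 = 0"
  shows "c $ 6 = 0" "c $ 7 = 0" "c $ 8 = 0" "c $ 9 = 0"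
proof -
  obtain N where N: "M ** N = mat 1"
    using M by (auto simp: Aut_def invertible_def)
  have "c \<bullet> br9 x y = 0" for x y
    using Aut_br9_transpose[OF M, of c "N *v x" "N *v y"] 0
    by (simp add: matrix_vector_mul_assoc N inner_br9[of "transpose M *v c"] del: transpose_matrix_vector)
  from this[of "axis 2 1" "axis 3 1"] this[of "axis 3 1" "axis 1 1"] this[of "axis 1 1" "axis 2 1"]
    this[of "axis 4 1" "axis 5 1"]
  show "c $ 6 = 0" "c $ 7 = 0" "c $ 8 = 0" "c $ 9 = 0"
    by (simp_all add: br9_surj inner_axis)
qed

lemma connected_Aut0: "connected (Aut0 br9)" and Aut0_subset: "Aut0 br9 \<subseteq> Aut br9"
  by (auto simp: Aut0_def dest: connected_component_in)

lemma mat1_Aut0: "mat 1 \<in> Aut0 br9"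
  by (auto simp: Aut0_def Aut_def invertible_mat_1)

text \<open>The lines of decomposable forms are permuted by every automorphism, hence fixed by the
  identity component.\<close>

lemma Aut0_fixes:
  assumes M: "M \<in> Aut0 br9" and c: "pluecker c" "c \<in> A" and A: "closed A" "closed B"
    and cover: "\<And>v. pluecker v \<Longrightarrow> v \<in> A \<union> B"
    and disj: "\<And>v. v \<in> A \<Longrightarrow> v \<in> B \<Longrightarrow> v$6 = 0 \<and> v$7 = 0 \<and> v$8 = 0 \<and> v$9 = 0"
    and nz: "c$6 \<noteq> 0 \<or> c$9 \<noteq> 0"
  shows "transpose M *v c \<in> A"
proof (rule ccontr)
  assume not: "transpose M *v c \<notin> A"
  let ?T = "\<lambda>M :: real^9^9. transpose M *v c"
  have "linear ?T"
    by (rule linearI) (simp_all add: transpose_def matrix_vector_mult_def vec_eq_iff sum.distrib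
        sum_distrib_left algebra_simps)
  then have "continuous_on UNIV ?T"
    unfolding linear_conv_bounded_linear by (rule linear_continuous_on)
  then have cl: "closed (?T -` A)" "closed (?T -` B)"
    using A by (simp_all add: continuous_on_closed_vimage)
  have "?T N \<in> A \<union> B" if "N \<in> Aut0 br9" for N
    using cover pluecker_transpose c(1) that Aut0_subset by blast
  then have "Aut0 br9 \<subseteq> ?T -` A \<union> ?T -` B" by blast
  moreover have "?T -` A \<inter> ?T -` B \<inter> Aut0 br9 = {}"
    using disj transpose_nonzero nz Aut0_subset by blast
  moreover have "mat 1 \<in> ?T -` A \<inter> Aut0 br9"
    using c(2) mat1_Aut0 by (simp add: transpose_mat del: transpose_matrix_vector)
  moreover have "M \<in> ?T -` B \<inter> Aut0 br9"
    using not M calculation(1) by blast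
  ultimately show False
    using connected_Aut0 cl unfolding connected_closed by blast
qed

lemma dline_zero:
  assumes "c \<in> dline a b" "c$6 = 0"
  shows "c$6 = 0 \<and> c$7 = 0 \<and> c$8 = 0 \<and> c$9 = 0"
  using assms by (simp add: dline_def)

text \<open>On components 6 to 9, the transpose of \<open>M\<close> has each of the five simplex
  vertices as an eigenvector. The relation between the vertices makes the eigenvalues equal; below
  this is carried out on the entries of \<open>M\<close>.\<close>

lemma Aut0_br9_center:
  assumes M: "M \<in> Aut0 br9"
  obtains b where "b \<noteq> 0" "\<And>x y. br9 (M *v x) (M *v y) = b *\<^sub>R br9 x y"
proof -
  let ?T = "\<lambda>c. transpose M *v c"
  have T0: "?T (axis 9 1) \<in> dline0"
  proof (rule Aut0_fixes[OF M pluecker_dline0 _ closed_dline(1)])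
    show "closed (dline 1 1 \<union> dline 1 (-1) \<union> (dline (-1) 1 \<union> dline (-1) (-1)))"
      by (intro closed_Un closed_dline)
    show "v \<in> dline0 \<union> (dline 1 1 \<union> dline 1 (-1) \<union> (dline (-1) 1 \<union> dline (-1) (-1)))"
      if "pluecker v" for v
      using pluecker_cases[OF that] by blast
  qed (auto simp: dline0_def axis9_nth dest: dline_zero)
  have T1: "?T (vec9 0 0 0 0 0 (sqrt 5) (sqrt 5 * a) (sqrt 5 * b) (a * b)) \<in> dline a b"
    if ab: "a = 1 \<or> a = -1" "b = 1 \<or> b = -1" for a b
  proof (rule Aut0_fixes[OF M pluecker_dline[OF ab] _ closed_dline(2)])
    show "closed (dline0 \<union> dline (-a) b \<union> (dline a (-b) \<union> dline (-a) (-b)))"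
      by (intro closed_Un closed_dline)
    show "v \<in> dline a b \<union> (dline0 \<union> dline (-a) b \<union> (dline a (-b) \<union> dline (-a) (-b)))"
      if "pluecker v" for v
      using pluecker_cases[OF that] ab by (elim disjE) simp_all
    show "v$6 = 0 \<and> v$7 = 0 \<and> v$8 = 0 \<and> v$9 = 0"
      if "v \<in> dline a b" "v \<in> dline0 \<union> dline (-a) b \<union> (dline a (-b) \<union> dline (-a) (-b))" for v
    proof (rule dline_zero[OF that(1)])
      have "a \<noteq> 0" "b \<noteq> 0"
        using ab by auto
      then show "v$6 = 0"
        using that by (auto simp: dline_def dline0_def)
    qed
  qed (use ab in \<open>auto simp: dline_def\<close>)
  have T: "?T c $ i = c$6 * M$6$i + c$7 * M$7$i + c$8 * M$8$i + c$9 * M$9$i"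
    if "c$1 = 0" "c$2 = 0" "c$3 = 0" "c$4 = 0" "c$5 = 0" for c i
    using that by (simp add: vector_matrix_mult_def sum_9 mult.commute)
  define b where "b = M$9$9"
  have M9: "M$9$6 = 0" "M$9$7 = 0" "M$9$8 = 0"
    using T0 by (simp_all add: dline0_def T axis9_nth del: transpose_matrix_vector)
  let ?t = "sqrt 5"
  have E: "M$6$7 + x * M$7$7 + y * M$8$7 = x * (M$6$6 + x * M$7$6 + y * M$8$6)"
    "M$6$8 + x * M$7$8 + y * M$8$8 = y * (M$6$6 + x * M$7$6 + y * M$8$6)"
    "?t * (M$6$9 + x * M$7$9 + y * M$8$9) + x * y * b = x * y * (M$6$6 + x * M$7$6 + y * M$8$6)"
    if "x = 1 \<or> x = -1" "y = 1 \<or> y = -1" for x y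
  proof -
    have "?t * (M$6$7 + x * M$7$7 + y * M$8$7) = ?t * (x * (M$6$6 + x * M$7$6 + y * M$8$6))"
      "?t * (M$6$8 + x * M$7$8 + y * M$8$8) = ?t * (y * (M$6$6 + x * M$7$6 + y * M$8$6))"
      "?t * (?t * (M$6$9 + x * M$7$9 + y * M$8$9) + x * y * b) =
         ?t * (x * y * (M$6$6 + x * M$7$6 + y * M$8$6))"
      using T1[OF that] M9 by (simp_all add: dline_def T b_def algebra_simps del: transpose_matrix_vector)
    then show "M$6$7 + x * M$7$7 + y * M$8$7 = x * (M$6$6 + x * M$7$6 + y * M$8$6)"
      "M$6$8 + x * M$7$8 + y * M$8$8 = y * (M$6$6 + x * M$7$6 + y * M$8$6)"
      "?t * (M$6$9 + x * M$7$9 + y * M$8$9) + x * y * b = x * y * (M$6$6 + x * M$7$6 + y * M$8$6)"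
      by simp_all
  qed
  \<comment> \<open>Sums and differences over the four sign choices isolate the individual
    entries.\<close>
  note E1 = E[of 1 1, simplified] and E2 = E[of 1 "-1", simplified] and E3 = E[of "-1" 1, simplified]
    and E4 = E[of "-1" "-1", simplified]
  have Z: "M$6$7 = 0" "M$6$8 = 0" "M$7$6 = 0" "M$7$8 = 0" "M$8$6 = 0" "M$8$7 = 0"
    "M$7$7 = M$6$6" "M$8$8 = M$6$6"
    using E1(1,2) E2(1,2) E3(1,2) E4(1,2) by linarith+
  have "?t * M$6$9 = 0" "?t * M$7$9 = 0" "?t * M$8$9 = 0" and 66: "M$6$6 = b"
    using E1(3) E2(3) E3(3) E4(3) unfolding Z by (simp_all only: distrib_left right_diff_distrib; linarith)+
  then have Z9: "M$6$9 = 0" "M$7$9 = 0" "M$8$9 = 0"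
    by simp_all
  have Tc: "?T c $ 6 = b * c$6" "?T c $ 7 = b * c$7" "?T c $ 8 = b * c$8" "?T c $ 9 = b * c$9"
    if "c$1 = 0" "c$2 = 0" "c$3 = 0" "c$4 = 0" "c$5 = 0" for c
    using T[OF that] Z Z9 M9 66 by (simp_all add: b_def del: transpose_matrix_vector)
  have "br9 (M *v x) (M *v y) = b *\<^sub>R br9 x y" for x y
  proof -
    have "axis i 1 \<bullet> br9 (M *v x) (M *v y) = b * (axis i 1 \<bullet> br9 x y)" if "i \<in> Z9" for i :: 9
      using that Aut_br9_transpose[OF Aut0_subset[THEN subsetD, OF M], of "axis i 1" x y] Tc[of "axis i 1"]
      by (auto simp: Z9_def inner_br9[of "transpose M *v _"] axis9_nth inner_axis' simp del: transpose_matrix_vector)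
    then have "br9 (M *v x) (M *v y) $ i = b * br9 x y $ i" if "i \<in> Z9" for i :: 9
      using that by (simp add: inner_axis')
    then show ?thesis
      by (simp add: vec9_eq_iff Z9_def del: br9_nth(6-9))
  qed
  moreover have "b \<noteq> 0"
    using transpose_nonzero(4)[of M "axis 9 1"] Tc[of "axis 9 1"] M Aut0_subset
    by (auto simp: axis9_nth simp del: transpose_matrix_vector)
  ultimately show ?thesis
    using that by blast
qed

text \<open>Kernels of the forms \<open>c \<bullet> br9 x y\<close> are preserved modulo the center, and suitable kernel
  vectors span the quotient by the center.\<close>

lemma Aut0_br9_block_scalar:
  assumes M: "M \<in> Aut0 br9"
  shows "block_scalar Z9 (M$4$4) ((M$4$4)\<^sup>2) M" "M$4$4 \<noteq> 0"
proof -
  obtain b where b: "b \<noteq> 0" "\<And>x y. br9 (M *v x) (M *v y) = b *\<^sub>R br9 x y"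
    using Aut0_br9_center[OF M] by blast
  have Aut: "M *v br9 x y = br9 (M *v x) (M *v y)" for x y
    using M Aut0_subset by (auto simp: Aut_def)
  obtain N where N: "M ** N = mat 1"
    using M Aut0_subset by (auto simp: Aut_def invertible_def)
  have ker: "c \<bullet> br9 (M *v v) y = 0" if "\<And>y. c \<bullet> br9 v y = 0" for c v y
    using b(2)[of v "N *v y"] that[of "N *v y"] by (simp add: matrix_vector_mul_assoc N)
  have Me: "(M *v v) $ i = M$i$1 * v$1 + M$i$2 * v$2 + M$i$3 * v$3 + M$i$4 * v$4 + M$i$5 * v$5
     + M$i$6 * v$6 + M$i$7 * v$7 + M$i$8 * v$8 + M$i$9 * v$9" for v i
    by (simp add: matrix_vector_mult_def sum_9)
  note s = inner_br9 axis9_nth Me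
  let ?e = "\<lambda>i. axis i 1 :: real^9"
  \<comment> \<open>Modulo the center, the forms numbered 6, 7 and 8 have one-dimensional kernels:
    three distinct lines in the plane of coordinates 4 and 5. Three invariant lines make
    \<open>M\<close> scalar on this plane modulo the center.\<close>
  have "?e 6 \<bullet> br9 (?e 5) y = 0" for y
    by (simp add: s)
  note k = ker[OF this]
  have 5: "M$1$5 = 0" "M$2$5 = 0" "M$3$5 = 0" "M$4$5 = 0"
    using k[of "?e 4"] k[of "?e 3"] k[of "?e 2"] k[of "?e 1"] by (simp_all add: s)
  have "?e 7 \<bullet> br9 (vec9 0 0 0 (sqrt 3) 1 0 0 0 0) y = 0" for y
    by (simp add: s)
  note k = ker[OF this]
  have "sqrt 2 * sqrt 3 * (M$4$4 - (sqrt 3 * M$5$4 + M$5$5)) = 0"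
    using k[of "?e 2"] by (simp add: s 5 algebra_simps real_sqrt_mult_self9)
  then have 4: "M$1$4 = 0" "M$3$4 = 0" "M$2$4 = 0" "M$4$4 = sqrt 3 * M$5$4 + M$5$5"
    using k[of "?e 1"] k[of "?e 3"] k[of "?e 4"] by (auto simp: s 5)
  have "?e 8 \<bullet> br9 (vec9 0 0 0 (sqrt 3) (-1) 0 0 0 0) y = 0" for y
    by (simp add: s)
  note k = ker[OF this]
  have "sqrt 2 * sqrt 3 * (M$4$4 - (M$5$5 - sqrt 3 * M$5$4)) = 0"
    using k[of "?e 3"] by (simp add: s 4(1-3) 5 algebra_simps real_sqrt_mult_self9)
  then have 54: "M$5$4 = 0" "M$5$5 = M$4$4"
    using 4(4) by simp_all
  have 1: "M$2$1 = 0" "M$3$1 = 0" "M$4$1 = 0"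
    "sqrt 2 * (sqrt 5 * (\<sigma> * M$1$1)) - 5 * M$5$1 - sqrt 2 * (sqrt 5 * (\<sigma> * M$4$4)) = 0"
    if \<sigma>: "\<sigma> = 1 \<or> \<sigma> = -1" for \<sigma>
  proof -
    \<comment> \<open>The kernels for the two signs differ only in the sign of coordinate 1. Adding
      and subtracting the two resulting relations separates \<open>M$5$1\<close> from
      \<open>M$1$1 - M$4$4\<close>.\<close>
    have "(?e 6 + \<sigma> *\<^sub>R ?e 9) \<bullet> br9 (vec9 (\<sigma> * sqrt 5) 0 0 0 (sqrt 2) 0 0 0 0) y = 0" for y
      using \<sigma> by (auto simp: s algebra_simps real_sqrt_mult_self9)
    note k = ker[OF this]
    show "M$2$1 = 0" "M$3$1 = 0" "M$4$1 = 0"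
      using k[of "?e 3"] k[of "?e 2"] k[of "?e 1"] \<sigma> by (auto simp: s 5)
    show "sqrt 2 * (sqrt 5 * (\<sigma> * M$1$1)) - 5 * M$5$1 - sqrt 2 * (sqrt 5 * (\<sigma> * M$4$4)) = 0"
      by (rule trans[OF _ k[of "?e 4"]], insert \<sigma>, elim disjE)
        (simp_all add: s 5 54 algebra_simps real_sqrt_mult_self9)
  qed
  have 2: "M$1$2 = 0" "M$3$2 = 0" "M$4$2 = sqrt 3 * M$5$2"
    "sqrt 5 * (\<sigma> * M$2$2) + 5 * (sqrt 2 * M$5$2) - sqrt 5 * (\<sigma> * M$4$4) = 0"
    if \<sigma>: "\<sigma> = 1 \<or> \<sigma> = -1" for \<sigma>
  proof -
    \<comment> \<open>Coordinates 4 and 5 repeat the kernel vector of form 7, on which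
      \<open>M\<close> is already known; again the sign only affects the remaining
      coordinate.\<close>
    let ?v = "vec9 0 (- \<sigma> * (sqrt 2 * sqrt 5)) 0 (sqrt 3) 1 0 0 0 0"
    have "(?e 7 + \<sigma> *\<^sub>R ?e 9) \<bullet> br9 ?v y = 0" for y
      using \<sigma> by (elim disjE) (simp_all add: s field_simps real_sqrt_mult_self9)
    note k = ker[OF this]
    show "M$1$2 = 0" "M$3$2 = 0"
      using k[of "?e 3"] k[of "?e 1"] \<sigma> by (auto simp: s 5 4)
    have "sqrt 5 * (M$4$2 - sqrt 3 * M$5$2) =
        - \<sigma> * ((?e 7 + \<sigma> *\<^sub>R ?e 9) \<bullet> br9 (M *v ?v) (?e 2))"
      by (insert \<sigma>, elim disjE) (simp_all add: s 5 4(1-3) 54 field_simps real_sqrt_mult_self9)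
    then show "M$4$2 = sqrt 3 * M$5$2"
      unfolding k by simp
    have "sqrt 5 * (\<sigma> * M$2$2) + 5 * (sqrt 2 * M$5$2) - sqrt 5 * (\<sigma> * M$4$4) =
        ((?e 7 + \<sigma> *\<^sub>R ?e 9) \<bullet> br9 (M *v ?v) (?e 4))"
      by (insert \<sigma>, elim disjE) (simp_all add: s 5 4(1-3) 54 field_simps real_sqrt_mult_self9)
    then show "sqrt 5 * (\<sigma> * M$2$2) + 5 * (sqrt 2 * M$5$2) - sqrt 5 * (\<sigma> * M$4$4) = 0"
      unfolding k by simp
  qed
  have 3: "M$1$3 = 0" "M$2$3 = 0" "M$4$3 = - sqrt 3 * M$5$3"
    "sqrt 5 * (\<sigma> * M$3$3) + 5 * (sqrt 2 * M$5$3) - sqrt 5 * (\<sigma> * M$4$4) = 0"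
    if \<sigma>: "\<sigma> = 1 \<or> \<sigma> = -1" for \<sigma>
  proof -
    let ?v = "vec9 0 0 (\<sigma> * (sqrt 2 * sqrt 5)) (sqrt 3) (-1) 0 0 0 0"
    have "(?e 8 + \<sigma> *\<^sub>R ?e 9) \<bullet> br9 ?v y = 0" for y
      using \<sigma> by (elim disjE) (simp_all add: s field_simps real_sqrt_mult_self9)
    note k = ker[OF this]
    show "M$1$3 = 0" "M$2$3 = 0"
      using k[of "?e 2"] k[of "?e 1"] \<sigma> by (auto simp: s 5 4)
    have "sqrt 5 * (M$4$3 + sqrt 3 * M$5$3) =
        \<sigma> * ((?e 8 + \<sigma> *\<^sub>R ?e 9) \<bullet> br9 (M *v ?v) (?e 3))"
      by (insert \<sigma>, elim disjE) (simp_all add: s 5 4(1-3) 54 field_simps real_sqrt_mult_self9)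
    then show "M$4$3 = - sqrt 3 * M$5$3"
      unfolding k by simp
    have "sqrt 5 * (\<sigma> * M$3$3) + 5 * (sqrt 2 * M$5$3) - sqrt 5 * (\<sigma> * M$4$4) =
        - ((?e 8 + \<sigma> *\<^sub>R ?e 9) \<bullet> br9 (M *v ?v) (?e 4))"
      by (insert \<sigma>, elim disjE) (simp_all add: s 5 4(1-3) 54 field_simps real_sqrt_mult_self9)
    then show "sqrt 5 * (\<sigma> * M$3$3) + 5 * (sqrt 2 * M$5$3) - sqrt 5 * (\<sigma> * M$4$4) = 0"
      unfolding k by simp
  qed
  have "5 * M$5$1 = 0" "sqrt 2 * (sqrt 5 * M$1$1) = sqrt 2 * (sqrt 5 * M$4$4)"
    "5 * (sqrt 2 * M$5$2) = 0" "sqrt 5 * M$2$2 = sqrt 5 * M$4$4"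
    "5 * (sqrt 2 * M$5$3) = 0" "sqrt 5 * M$3$3 = sqrt 5 * M$4$4"
    using 1(4)[of 1, simplified] 1(4)[of "-1", simplified] 2(4)[of 1, simplified]
      2(4)[of "-1", simplified] 3(4)[of 1, simplified] 3(4)[of "-1", simplified] by linarith+
  then have diag: "M$5$1 = 0" "M$1$1 = M$4$4" "M$5$2 = 0" "M$2$2 = M$4$4" "M$5$3 = 0" "M$3$3 = M$4$4"
    by simp_all
  have off: "M$2$1 = 0" "M$3$1 = 0" "M$4$1 = 0" "M$1$2 = 0" "M$3$2 = 0" "M$4$2 = 0"
    "M$1$3 = 0" "M$2$3 = 0" "M$4$3 = 0"
    using 1(1-3)[of 1] 2(1-3)[of 1] 3(1-3)[of 1] diag by simp_all
  have center: "M *v axis i 1 = b *\<^sub>R axis i 1" if "i \<in> Z9" for i :: 9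
  proof -
    have "M *v z = b *\<^sub>R z" if "br9 x y = r *\<^sub>R z" "r \<noteq> 0" for r x y z
    proof -
      have "r *\<^sub>R (M *v z) = r *\<^sub>R (b *\<^sub>R z)"
        using Aut[of x y] b(2)[of x y] that by (simp add: matrix_vector_mult_scaleR)
      then show ?thesis
        using that(2) by (simp only: scaleR_cancel_left) simp
    qed
    from this[OF br9_surj(1)] this[OF br9_surj(2)] this[OF br9_surj(3)] this[OF br9_surj(4)]
    show ?thesis
      using that by (auto simp: Z9_def)
  qed
  have cols: "M$j$i = (if i = j then b else 0)" if "i \<in> Z9" for i j
    using arg_cong[OF center[OF that], of "\<lambda>v. v $ j"]
    by (simp add: matrix_vector_mul_component inner_axis axis9_nth)
  have colsZ: "M$j$6 = (if 6 = j then b else 0)" "M$j$7 = (if 7 = j then b else 0)"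
    "M$j$8 = (if 8 = j then b else 0)" "M$j$9 = (if 9 = j then b else 0)" for j
    by (simp_all add: cols Z9_def)
  have "b = (M$4$4)\<^sup>2"
    using arg_cong[OF b(2)[of "?e 4" "?e 5"], of "\<lambda>v. v $ 9"]
    by (simp add: s 5 54 power2_eq_square)
  then show "M$4$4 \<noteq> 0"
    using b(1) by auto
  show "block_scalar Z9 (M$4$4) ((M$4$4)\<^sup>2) M"
    unfolding block_scalar_def coord_space_Z9 \<open>b = (M$4$4)\<^sup>2\<close>[symmetric]
    by (auto simp: coord_space_Z9 vec9_eq_iff Me off diag colsZ 4(1-3) 5 54)
qed

text \<open>The scalar on the quotient depends continuously on \<open>M\<close> and never vanishes,
  so on the identity component it keeps the sign it has at the identity.\<close>

lemma Aut0_br9: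
  assumes M: "M \<in> Aut0 br9"
  shows "\<exists>a>0. block_scalar Z9 a (a\<^sup>2) M"
proof -
  have "connected ((\<lambda>M. M$4$4) ` Aut0 br9)"
    by (intro connected_continuous_image connected_Aut0 continuous_intros)
  moreover have "0 \<notin> (\<lambda>M. M$4$4) ` Aut0 br9"
    using Aut0_br9_block_scalar(2) by auto
  moreover have "1 \<in> (\<lambda>M. M$4$4) ` Aut0 br9"
    using mat1_Aut0 by (force simp: mat_def)
  moreover have "M$4$4 \<in> (\<lambda>M. M$4$4) ` Aut0 br9"
    using M by blast
  ultimately have "M$4$4 > 0"
    using connectedD_interval[of _ "M$4$4" 1 0] by (metis not_le zero_le_one)
  then show ?thesis
    using Aut0_br9_block_scalar(1)[OF M] by blast
qed

theorem theoremA: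
  shows "\<exists>(G :: (real^9) monoid) (A :: (real^9, real^9) chart set)
            (br :: real^9 \<Rightarrow> real^9 \<Rightarrow> real^9).
           nilpotent_lie_group G A br \<and>
           (\<exists>g. left_invariant_metric G A g \<and> ricci_soliton A g) \<and>
           \<not> transitive_on_GL_mod_O (RAut0 br) \<and>
           (\<forall>p\<in>GL_mod_O. \<forall>q\<in>GL_mod_O.
              congruent_orbits (GL_orbit (RAut0 br) p) (GL_orbit (RAut0 br) q))"
proof (intro exI conjI)
  show "nilpotent_lie_group br9.lie_grp id_atlas br9"
    by (rule br9.nilpotent_lie_group_lie_grp)
  show "left_invariant_metric br9.lie_grp id_atlas (\<lambda>c. br9.metric)"
    by (rule br9.left_invariant_metric_lie_grp)
  show "ricci_soliton id_atlas (\<lambda>c. br9.metric)"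
    by (rule ricci_soliton_br9)
  have RAut0: "RAut0 br9 = block_scalars Z9"
    by (rule br9.RAut0_eq[OF Aut0_br9])
  show "\<not> transitive_on_GL_mod_O (RAut0 br9)"
    unfolding RAut0 by (rule not_transitive_block_scalars[of 1 _ 2]) (simp_all add: Z9_def)
  show "\<forall>p\<in>GL_mod_O. \<forall>q\<in>GL_mod_O.
      congruent_orbits (GL_orbit (RAut0 br9) p) (GL_orbit (RAut0 br9) q)"
    unfolding RAut0 using congruent_orbits_block_scalars by blast
qed

end
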